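(* Let $d,r\ge 2$ be integers. Then: (i) for $A=SV_d^{(r)}$, the toric ideal $I_A$ is generated by $C_A^{\mathrm{sfsf}}$; (ii) for $A=V_d^{(r)}$, the toric ideal $I_A$ is generated by $C_A^{\mathrm{sf}}$ if and only if $r=2$.
   Context: $V_d^{(r)}$ is the matrix with $d$ rows whose columns are (in some order, each once) all vectors $(\alpha_1,\dots,\alpha_d)^\top\in\mathbb{Z}_{\ge0}^d$ with $\sum_i\alpha_i=r$. $SV_d^{(r)}$ is the matrix with $d$ rows whose columns are (each once) all vectors $(\alpha_1,\dots,\alpha_d)^\top\in\{0,1\}^d$ with $\sum_i\alpha_i=r$. Let $K$ be a field. For an integer matrix $A\in\mathbb{Z}^{d\times n}$ with columns $\mathbf{a}_1,\dots,\mathbf{a}_n$, the toric ideal $I_A$ is the kernel of the $K$-algebra map $\pi:K[X]=K[x_1,\dots,x_n]\to K[t_1^{\pm1},\dots,t_d^{\pm1}]$, $x_j\mapsto T^{\mathbf{a}_j}=t_1^{a_{1j}}\cdots t_d^{a_{dj}}$. A binomial is a difference $u-v$ of two distinct monomials. The support of a monomial $u$ is $\mathrm{supp}(u)=\{x_i : x_i \mid u\}$, and $\mathrm{supp}(u-v)=\mathrm{supp}(u)\cup\mathrm{supp}(v)$. An irreducible binomial $f\in I_A$ is a circuit of $I_A$ if there is no binomial $g\in I_A$ with $\mathrm{supp}(g)\subsetneq\mathrm{supp}(f)$. $C_A$ denotes the set of circuits of $I_A$; $C_A^{\mathrm{sf}}$ is the set of circuits $u-v\in C_A$ such that at least one of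 $u,v$ is squarefree; $C_A^{\mathrm{sfsf}}$ is the set of circuits $u-v\in C_A$ such that both $u$ and $v$ are squarefree. The ideal generated by the empty set is the zero ideal. *)

theory Defs
  imports
    "HOL-Library.Poly_Mapping"
    "HOL-Algebra.Ring_Divisibility"
    "HOL-Algebra.QuotRing"
    "Jordan_Normal_Form.Matrix"
begin

text \<open>
  Monomials are exponent vectors of type \<open>nat \<Rightarrow>\<^sub>0 nat\<close>, polynomials are finitely supported
  functions from monomials to coefficients. Everything is indexed from \<open>0\<close>: the ring
  \<open>K[x\<^sub>0, \<dots>, x\<^bsub>n-1\<^esub>]\<close> consists of those polynomials which involve no other variable.
\<close>

type_synonym monomial = "nat \<Rightarrow>\<^sub>0 nat"
type_synonym 'k mpoly = "monomial \<Rightarrow>\<^sub>0 'k"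
type_synonym 'k laurent = "(nat \<Rightarrow>\<^sub>0 int) \<Rightarrow>\<^sub>0 'k"

definition mpoly_ring :: "nat \<Rightarrow> 'k::field mpoly ring" where
  "mpoly_ring n =
     \<lparr>carrier = {p. \<forall>m\<in>Poly_Mapping.keys p. Poly_Mapping.keys m \<subseteq> {..<n}},
      mult = (*), one = 1, zero = 0, add = (+)\<rparr>"

definition mono_poly :: "monomial \<Rightarrow> 'k::field mpoly" where
  "mono_poly u = Poly_Mapping.single u 1"

definition laurent_monomial :: "int mat \<Rightarrow> nat \<Rightarrow> 'k::field laurent" where
  "laurent_monomial A j =
     (\<Prod>i<dim_row A. Poly_Mapping.single (Poly_Mapping.single i (A $$ (i, j))) 1)"

definition toric_map :: "int mat \<Rightarrow> 'k::field mpoly \<Rightarrow> 'k laurent" where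
  "toric_map A p =
     (\<Sum>m\<in>Poly_Mapping.keys p. Poly_Mapping.single 0 (Poly_Mapping.lookup p m) *
        (\<Prod>j<dim_col A. laurent_monomial A j ^ Poly_Mapping.lookup m j))"

definition toric_ideal :: "int mat \<Rightarrow> 'k::field mpoly set" where
  "toric_ideal A = {p \<in> carrier (mpoly_ring (dim_col A)). toric_map A p = 0}"

definition is_binomial :: "'k::field mpoly \<Rightarrow> bool" where
  "is_binomial f \<longleftrightarrow> (\<exists>u v. u \<noteq> v \<and> f = mono_poly u - mono_poly v)"

text \<open>
  A variable is identified with its index. If \<open>u \<noteq> v\<close>, then \<open>u\<close> and \<open>v\<close> both occur in \<open>u - v\<close>
  (with coefficients \<open>1\<close> and \<open>-1\<close>), so on binomials this is the union of the two supports.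
\<close>

definition supp :: "'k::field mpoly \<Rightarrow> nat set" where
  "supp f = (\<Union>m\<in>Poly_Mapping.keys f. Poly_Mapping.keys m)"

definition squarefree_monomial :: "monomial \<Rightarrow> bool" where
  "squarefree_monomial u \<longleftrightarrow> (\<forall>j. Poly_Mapping.lookup u j \<le> 1)"

definition circuits :: "int mat \<Rightarrow> 'k::field mpoly set" where
  "circuits A =
     {f \<in> toric_ideal A. is_binomial f \<and> ring_irreducible\<^bsub>mpoly_ring (dim_col A)\<^esub> f \<and>
        \<not> (\<exists>g\<in>toric_ideal A :: 'k mpoly set. is_binomial g \<and> supp g \<subset> supp f)}"

definition circuits_sf :: "int mat \<Rightarrow> 'k::field mpoly set" where
  "circuits_sf A =
     {f \<in> circuits A. \<exists>u v. u \<noteq> v \<and> f = mono_poly u - mono_poly v \<and>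
        (squarefree_monomial u \<or> squarefree_monomial v)}"

definition circuits_sfsf :: "int mat \<Rightarrow> 'k::field mpoly set" where
  "circuits_sfsf A =
     {f \<in> circuits A. \<exists>u v. u \<noteq> v \<and> f = mono_poly u - mono_poly v \<and>
        squarefree_monomial u \<and> squarefree_monomial v}"

definition is_V :: "nat \<Rightarrow> nat \<Rightarrow> int mat \<Rightarrow> bool" where
  "is_V d r A \<longleftrightarrow> dim_row A = d \<and> distinct (cols A) \<and>
     set (cols A) = {\<alpha> \<in> carrier_vec d. (\<forall>i<d. 0 \<le> \<alpha> $ i) \<and> (\<Sum>i<d. \<alpha> $ i) = int r}"

definition is_SV :: "nat \<Rightarrow> nat \<Rightarrow> int mat \<Rightarrow> bool" where
  "is_SV d r A \<longleftrightarrow> dim_row A = d \<and> distinct (cols A) \<and>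
     set (cols A) = {\<alpha> \<in> carrier_vec d. (\<forall>i<d. \<alpha> $ i \<in> {0, 1}) \<and> (\<Sum>i<d. \<alpha> $ i) = int r}"

text \<open>
  \<open>genideal\<close> intersects all \<open>I\<close> with \<open>ideal I R\<close>, a locale that includes \<open>ring R\<close>; the next
  lemma ensures that it is the generated ideal in the usual sense.
\<close>

lemma cring_mpoly_ring: "cring (mpoly_ring n :: 'k::field mpoly ring)"
proof -
  let ?C = "{p :: 'k mpoly. \<forall>m\<in>Poly_Mapping.keys p. Poly_Mapping.keys m \<subseteq> {..<n}}"
  have add: "p + q \<in> ?C" if "p \<in> ?C" "q \<in> ?C" for p q
    using that Poly_Mapping.keys_add[of p q] by blast
  have mult: "p * q \<in> ?C" if pq: "p \<in> ?C" "q \<in> ?C" for p q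
  proof safe
    fix m j assume "m \<in> Poly_Mapping.keys (p * q)" and j: "j \<in> Poly_Mapping.keys m"
    then obtain a b where ab: "m = a + b" "a \<in> Poly_Mapping.keys p" "b \<in> Poly_Mapping.keys q"
      using keys_mult[of p q] by blast
    have "j \<in> Poly_Mapping.keys a \<union> Poly_Mapping.keys b"
      using j ab(1) Poly_Mapping.keys_add[of a b] by blast
    with pq ab(2,3) show "j < n" by blast
  qed
  have uminus: "- p \<in> ?C" if "p \<in> ?C" for p
    using that by simp
  have one: "1 \<in> ?C"
    by (simp flip: single_one)
  show ?thesis
  proof (rule cringI)
    show "abelian_group (mpoly_ring n :: 'k mpoly ring)"
    proof (rule abelian_groupI)
      fix p :: "'k mpoly" assume "p \<in> carrier (mpoly_ring n)"
      then show "\<exists>q\<in>carrier (mpoly_ring n). q \<oplus>\<^bsub>mpoly_ring n\<^esub> p = \<zero>\<^bsub>mpoly_ring n\<^esub>"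
        using uminus[of p] by (intro bexI[of _ "- p"]) (auto simp: mpoly_ring_def)
    next
      fix p q :: "'k mpoly" assume "p \<in> carrier (mpoly_ring n)" "q \<in> carrier (mpoly_ring n)"
      then show "p \<oplus>\<^bsub>mpoly_ring n\<^esub> q \<in> carrier (mpoly_ring n)"
        unfolding mpoly_ring_def partial_object.simps monoid.simps ring.simps by (rule add)
    qed (simp_all add: mpoly_ring_def ac_simps)
    show "Group.comm_monoid (mpoly_ring n :: 'k mpoly ring)"
    proof (rule comm_monoidI)
      fix p q :: "'k mpoly" assume "p \<in> carrier (mpoly_ring n)" "q \<in> carrier (mpoly_ring n)"
      then show "p \<otimes>\<^bsub>mpoly_ring n\<^esub> q \<in> carrier (mpoly_ring n)"
        unfolding mpoly_ring_def partial_object.simps monoid.simps ring.simps by (rule mult)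
    next
      show "\<one>\<^bsub>mpoly_ring n\<^esub> \<in> carrier (mpoly_ring n :: 'k mpoly ring)"
        unfolding mpoly_ring_def partial_object.simps monoid.simps ring.simps by (rule one)
    qed (simp_all add: mpoly_ring_def ac_simps)
  qed (simp add: mpoly_ring_def distrib_right)
qed

text \<open>The columns of the matrices are only fixed up to order; such matrices exist.\<close>

lemma finite_V_columns:
  "finite {\<alpha> \<in> carrier_vec d. (\<forall>i<d. 0 \<le> \<alpha> $ i) \<and> (\<Sum>i<d. \<alpha> $ i) = int r}" (is "finite ?S")
proof (rule finite_subset)
  show "?S \<subseteq> vec_of_list ` {xs. set xs \<subseteq> {0..int r} \<and> length xs = d}"
  proof
    fix \<alpha> assume \<alpha>: "\<alpha> \<in> ?S"
    have "\<alpha> $ i \<le> int r" if "i < d" for i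
      using \<alpha> that member_le_sum[of i "{..<d}" "\<lambda>i. \<alpha> $ i"] by auto
    then have "set (list_of_vec \<alpha>) \<subseteq> {0..int r} \<and> length (list_of_vec \<alpha>) = d"
      using \<alpha> by (auto simp: set_list_of_vec vec_set_def)
    then show "\<alpha> \<in> vec_of_list ` {xs. set xs \<subseteq> {0..int r} \<and> length xs = d}"
      by (intro image_eqI[of _ _ "list_of_vec \<alpha>"]) (auto simp: vec_list)
  qed
qed (rule finite_imageI, rule finite_lists_length_eq, rule finite_atLeastAtMost_int)

lemma ex_matrix_with_columns:
  assumes "finite S" "S \<subseteq> carrier_vec d"
  shows "\<exists>A. dim_row A = d \<and> distinct (cols A) \<and> set (cols A) = S"
proof -
  obtain xs where "set xs = S" "distinct xs"
    using finite_distinct_list[OF assms(1)] by blast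
  with assms(2) show ?thesis
    by (intro exI[of _ "mat_of_cols d xs"]) simp
qed

lemma ex_is_V: "\<exists>A. is_V d r A"
  unfolding is_V_def by (rule ex_matrix_with_columns[OF finite_V_columns]) auto

lemma ex_is_SV: "\<exists>A. is_SV d r A"
  unfolding is_SV_def
proof (rule ex_matrix_with_columns[OF finite_subset[OF _ finite_V_columns[of d r]]])
  have "0 \<le> x" if "x \<in> {0, 1}" for x :: int
    using that by auto
  then show "{\<alpha> \<in> carrier_vec d. (\<forall>i<d. \<alpha> $ i \<in> {0, 1}) \<and> (\<Sum>i<d. \<alpha> $ i) = int r}
      \<subseteq> {\<alpha> \<in> carrier_vec d. (\<forall>i<d. 0 \<le> \<alpha> $ i) \<and> (\<Sum>i<d. \<alpha> $ i) = int r}"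
    by blast
qed blast

end

theory Submission
  imports Defs
begin

text \<open>
  The columns of both matrices are the lattice points of a dilated simplex with entries at most
  \<open>c\<close>. Two monomials \<open>u\<close>, \<open>v\<close> of the same degree can be joined by quadratic moves: among all
  monomials reachable from \<open>u\<close> and from \<open>v\<close>, take a column \<open>a\<close> of the former and \<open>e\<close> of the
  latter at minimal distance. If \<open>a \<noteq> e\<close>, pick \<open>i\<close> with \<open>a\<^sub>i < e\<^sub>i\<close> and \<open>j\<close> with \<open>e\<^sub>j < a\<^sub>j\<close>; comparing
  the degrees in \<open>i\<close> and \<open>j\<close>, one of the two sides contains another column with which a unit can be
  exchanged, which brings \<open>a\<close> and \<open>e\<close> closer. Hence \<open>a = e\<close> can be cancelled, and the toric ideal is
  generated by quadrics.

  If \<open>c \<le> 2\<close>, every such quadric is a circuit, because no four distinct columns are collinear. If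
  \<open>r \<ge> 3\<close>, the columns \<open>(r, 0)\<close>, \<open>(r - 1, 1)\<close>, \<open>(r - 2, 2)\<close>, \<open>(r - 3, 3)\<close> (padded with zeros) give a
  quadric that is needed in every generating set of binomials but is not a circuit.
\<close>

section \<open>Polynomials\<close>

lemma carrier_mpoly_ring:
  "p \<in> carrier (mpoly_ring n) \<longleftrightarrow> (\<forall>m\<in>Poly_Mapping.keys p. Poly_Mapping.keys m \<subseteq> {..<n})"
  by (simp add: mpoly_ring_def)

lemma mpoly_ring_simps [simp]:
  "x \<otimes>\<^bsub>mpoly_ring n\<^esub> y = x * y" "x \<oplus>\<^bsub>mpoly_ring n\<^esub> y = x + y"
  "\<one>\<^bsub>mpoly_ring n\<^esub> = 1" "\<zero>\<^bsub>mpoly_ring n\<^esub> = 0"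
  by (simp_all add: mpoly_ring_def)

lemma keys_add_monomial:
  fixes u v :: monomial
  shows "Poly_Mapping.keys (u + v) = Poly_Mapping.keys u \<union> Poly_Mapping.keys v"
  by (auto simp: in_keys_iff lookup_add)

lemma single_in_carrier:
  "Poly_Mapping.keys m \<subseteq> {..<n} \<Longrightarrow> Poly_Mapping.single m c \<in> carrier (mpoly_ring n)"
  by (auto simp: carrier_mpoly_ring)

lemma lookup_mono_poly: "Poly_Mapping.lookup (mono_poly u) m = (if m = u then 1 else 0)"
  by (auto simp: mono_poly_def lookup_single when_def)

lemma keys_binomial:
  "u \<noteq> v \<Longrightarrow> Poly_Mapping.keys (mono_poly u - mono_poly v :: 'k::field mpoly) = {u, v}"
  by (auto simp: in_keys_iff lookup_minus lookup_mono_poly split: if_splits)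

lemma mono_poly_add: "mono_poly (u + v) = mono_poly u * mono_poly v"
  by (simp add: mono_poly_def mult_single)

lemma domain_mpoly_ring: "domain (mpoly_ring n :: 'k::field mpoly ring)"
proof -
  interpret cring "mpoly_ring n :: 'k mpoly ring" by (rule cring_mpoly_ring)
  show ?thesis by unfold_locales auto
qed

text \<open>Negation is multiplication by the constant polynomial \<open>- 1\<close>, so the
  additive subgroup condition follows from closure under sums and multiples.\<close>

lemma mpoly_idealI:
  fixes I :: "'k::field mpoly set"
  assumes sub: "I \<subseteq> carrier (mpoly_ring n)" and zero: "0 \<in> I"
    and add: "\<And>p q. p \<in> I \<Longrightarrow> q \<in> I \<Longrightarrow> p + q \<in> I"
    and mult: "\<And>p q. p \<in> I \<Longrightarrow> q \<in> carrier (mpoly_ring n) \<Longrightarrow> q * p \<in> I"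
  shows "ideal I (mpoly_ring n)"
proof -
  interpret cring "mpoly_ring n :: 'k mpoly ring" by (rule cring_mpoly_ring)
  have uminus: "- p \<in> I" if "p \<in> I" for p
  proof -
    have "- 1 \<in> carrier (mpoly_ring n :: 'k mpoly ring)"
      by (simp add: carrier_mpoly_ring)
    from mult[OF that this] show ?thesis by simp
  qed
  have inv: "\<ominus>\<^bsub>mpoly_ring n\<^esub> p \<in> I" if "p \<in> I" for p
  proof -
    have "\<ominus>\<^bsub>mpoly_ring n\<^esub> p = - p"
      using that sub uminus[OF that] by (intro minus_equality) auto
    then show ?thesis using uminus[OF that] by simp
  qed
  show ?thesis
  proof (rule idealI)
    show "subgroup I (add_monoid (mpoly_ring n))"
      using sub zero add inv
      by (intro subgroup.intro) (auto simp: a_inv_def)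
  qed (use mult in \<open>auto simp: mult.commute intro: ring_axioms\<close>)
qed

lemma mpoly_idealD:
  fixes I :: "'k::field mpoly set"
  assumes "ideal I (mpoly_ring n)"
  shows "I \<subseteq> carrier (mpoly_ring n)" and "0 \<in> I"
    and "p \<in> I \<Longrightarrow> q \<in> I \<Longrightarrow> p + q \<in> I"
    and "p \<in> I \<Longrightarrow> q \<in> carrier (mpoly_ring n) \<Longrightarrow> q * p \<in> I"
    and "p \<in> I \<Longrightarrow> - p \<in> I"
proof -
  interpret ideal I "mpoly_ring n" by fact
  show "I \<subseteq> carrier (mpoly_ring n)" by (rule a_subset)
  show "0 \<in> I" using additive_subgroup.zero_closed[OF additive_subgroup_axioms] by simp
  show "p \<in> I \<Longrightarrow> q \<in> I \<Longrightarrow> p + q \<in> I" using additive_subgroup.a_closed[OF additive_subgroup_axioms, of p q] by simp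
  show *: "p \<in> I \<Longrightarrow> q \<in> carrier (mpoly_ring n) \<Longrightarrow> q * p \<in> I" for p q
    using I_l_closed[of p q] by simp
  have "- 1 \<in> carrier (mpoly_ring n :: 'k mpoly ring)"
    by (simp add: carrier_mpoly_ring)
  with *[of p "- 1"] show "p \<in> I \<Longrightarrow> - p \<in> I" by simp
qed

section \<open>Extremal monomials of a product with respect to a weight\<close>

lemma poly_mapping_eq_sum_single:
  "(\<Sum>m\<in>Poly_Mapping.keys p. Poly_Mapping.single m (Poly_Mapping.lookup p m)) = p"
proof (rule poly_mapping_eqI)
  fix k
  show "Poly_Mapping.lookup (\<Sum>m\<in>Poly_Mapping.keys p. Poly_Mapping.single m (Poly_Mapping.lookup p m)) k
    = Poly_Mapping.lookup p k"
    by (simp add: lookup_sum lookup_single when_def sum.delta in_keys_iff)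
qed

text \<open>If \<open>p + q\<close> arises in one way only, nothing can cancel there: its
  coefficient in the product is a single product of two nonzero field elements.\<close>

lemma lookup_times_unique:
  fixes g h :: "'k::field mpoly"
  assumes "p \<in> Poly_Mapping.keys g" "q \<in> Poly_Mapping.keys h"
    and uniq: "\<And>m k. \<lbrakk>m \<in> Poly_Mapping.keys g; k \<in> Poly_Mapping.keys h; m + k = p + q\<rbrakk> \<Longrightarrow> m = p \<and> k = q"
  shows "p + q \<in> Poly_Mapping.keys (g * h)"
proof -
  have "g * h = (\<Sum>m\<in>Poly_Mapping.keys g. \<Sum>k\<in>Poly_Mapping.keys h.
      Poly_Mapping.single (m + k) (Poly_Mapping.lookup g m * Poly_Mapping.lookup h k))"
    by (subst poly_mapping_eq_sum_single[of g, symmetric], subst poly_mapping_eq_sum_single[of h, symmetric])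
       (simp add: sum_product mult_single)
  then have "Poly_Mapping.lookup (g * h) (p + q) =
      (\<Sum>m\<in>Poly_Mapping.keys g. \<Sum>k\<in>Poly_Mapping.keys h.
        (Poly_Mapping.lookup g m * Poly_Mapping.lookup h k when m + k = p + q))"
    by (simp add: lookup_sum lookup_single)
  also have "\<dots> = (\<Sum>m\<in>Poly_Mapping.keys g. \<Sum>k\<in>Poly_Mapping.keys h.
        if m = p \<and> k = q then Poly_Mapping.lookup g p * Poly_Mapping.lookup h q else 0)"
    using uniq by (intro sum.cong refl) (auto simp: when_def)
  also have "\<dots> = (\<Sum>m\<in>Poly_Mapping.keys g. if m = p then Poly_Mapping.lookup g p * Poly_Mapping.lookup h q else 0)"
    using assms(2) by (intro sum.cong refl) (auto simp: sum.delta)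
  also have "\<dots> = Poly_Mapping.lookup g p * Poly_Mapping.lookup h q"
    using assms(1) by (simp add: sum.delta)
  finally show ?thesis using assms(1,2) by (simp add: in_keys_iff)
qed

text \<open>The maximum for the lexicographic combination of the weight \<open>w\<close> with the
  linear order on monomials. The weight alone may be maximal at several monomials.\<close>

lemma weight_max_keys:
  fixes g :: "'k::field mpoly" and w :: "monomial \<Rightarrow> int"
  assumes "g \<noteq> 0"
  obtains p where "p \<in> Poly_Mapping.keys g" "\<And>m. m \<in> Poly_Mapping.keys g \<Longrightarrow> w m < w p \<or> (w m = w p \<and> m \<le> p)"
proof -
  let ?K = "Poly_Mapping.keys g"
  let ?M = "{m \<in> ?K. w m = Max (w ` ?K)}"
  have K: "finite ?K" "?K \<noteq> {}" using assms by auto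
  then have "Max (w ` ?K) \<in> w ` ?K" by (intro Max_in) auto
  then have ne: "?M \<noteq> {}" by auto
  have fin: "finite ?M" using K by simp
  show ?thesis
  proof
    have Mx: "Max ?M \<in> ?M" by (rule Max_in[OF fin ne])
    then show "Max ?M \<in> ?K" by auto
    fix m assume m: "m \<in> ?K"
    have "w m \<le> Max (w ` ?K)" using K m by simp
    moreover have "m \<le> Max ?M" if "w m = Max (w ` ?K)"
      using that m fin by (intro Max_ge) auto
    ultimately show "w m < w (Max ?M) \<or> (w m = w (Max ?M) \<and> m \<le> Max ?M)"
      using Mx by (cases "w m = Max (w ` ?K)") auto
  qed
qed

text \<open>The linear order on monomials only serves to break ties.\<close>

lemma weight_max_mult:
  fixes g h :: "'k::field mpoly" and w :: "monomial \<Rightarrow> int"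
  assumes "g \<noteq> 0" "h \<noteq> 0" and w: "\<And>m k. w (m + k) = w m + w k"
  obtains p q where "p \<in> Poly_Mapping.keys g" "q \<in> Poly_Mapping.keys h" "p + q \<in> Poly_Mapping.keys (g * h)"
    "\<And>m. m \<in> Poly_Mapping.keys g \<Longrightarrow> w m \<le> w p" "\<And>k. k \<in> Poly_Mapping.keys h \<Longrightarrow> w k \<le> w q"
proof -
  obtain p where p: "p \<in> Poly_Mapping.keys g"
      "\<And>m. m \<in> Poly_Mapping.keys g \<Longrightarrow> w m < w p \<or> (w m = w p \<and> m \<le> p)"
    using weight_max_keys[OF assms(1)] by blast
  obtain q where q: "q \<in> Poly_Mapping.keys h"
      "\<And>m. m \<in> Poly_Mapping.keys h \<Longrightarrow> w m < w q \<or> (w m = w q \<and> m \<le> q)"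
    using weight_max_keys[OF assms(2)] by blast
  have "p + q \<in> Poly_Mapping.keys (g * h)"
  proof (rule lookup_times_unique[OF p(1) q(1)])
    fix m k assume mk: "m \<in> Poly_Mapping.keys g" "k \<in> Poly_Mapping.keys h" "m + k = p + q"
    \<comment> \<open>Equal total weights leave no room for a strict drop in either factor, so both
      comparisons are decided by the linear order, which is strictly compatible with
      addition.\<close>
    have "w m + w k = w p + w q" using w[of m k] w[of p q] mk(3) by simp
    then have le: "m \<le> p" "k \<le> q" using p(2)[OF mk(1)] q(2)[OF mk(2)] by linarith+
    have "m = p"
    proof (rule ccontr)
      assume "m \<noteq> p"
      then have "m + k < p + q" using le by (intro add_less_le_mono) auto
      then show False using mk(3) by simp
    qed
    then show "m = p \<and> k = q" using mk(3) by simp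
  qed
  moreover have "\<And>m. m \<in> Poly_Mapping.keys g \<Longrightarrow> w m \<le> w p" "\<And>k. k \<in> Poly_Mapping.keys h \<Longrightarrow> w k \<le> w q"
    using p(2) q(2) by fastforce+
  ultimately show thesis using that p(1) q(1) by blast
qed

text \<open>A heaviest monomial of the product is the product of heaviest monomials of the factors,
  and likewise for the lightest (weight \<open>- w\<close>). If the product is homogeneous, the
  maxima and the minima have the same total, which forces maximum and minimum to agree in each
  factor.\<close>

lemma weight_constant_factor:
  fixes g h :: "'k::field mpoly" and w :: "monomial \<Rightarrow> int"
  assumes "g \<noteq> 0" "h \<noteq> 0" and w: "\<And>m k. w (m + k) = w m + w k"
    and const: "\<And>m. m \<in> Poly_Mapping.keys (g * h) \<Longrightarrow> w m = c"
    and "m \<in> Poly_Mapping.keys h" "m' \<in> Poly_Mapping.keys h"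
  shows "w m = w m'"
proof -
  obtain p q where pq: "p \<in> Poly_Mapping.keys g" "q \<in> Poly_Mapping.keys h" "p + q \<in> Poly_Mapping.keys (g * h)"
    "\<And>m. m \<in> Poly_Mapping.keys g \<Longrightarrow> w m \<le> w p" "\<And>k. k \<in> Poly_Mapping.keys h \<Longrightarrow> w k \<le> w q"
    using weight_max_mult[OF assms(1,2), of w] w by blast
  have "- w (m + k) = - w m + - w k" for m k using w by simp
  then obtain p' q' where pq': "p' \<in> Poly_Mapping.keys g" "q' \<in> Poly_Mapping.keys h" "p' + q' \<in> Poly_Mapping.keys (g * h)"
    "\<And>m. m \<in> Poly_Mapping.keys g \<Longrightarrow> - w m \<le> - w p'" "\<And>k. k \<in> Poly_Mapping.keys h \<Longrightarrow> - w k \<le> - w q'"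
    using weight_max_mult[OF assms(1,2), of "\<lambda>m. - w m"] by blast
  have "w p + w q = w p' + w q'" using const[OF pq(3)] const[OF pq'(3)] w by simp
  then have "w q = w q'"
    using pq(4)[OF pq'(1)] pq(5)[OF pq'(2)] by linarith
  then show ?thesis
    using pq(5)[OF assms(5)] pq(5)[OF assms(6)] pq'(5)[OF assms(5)] pq'(5)[OF assms(6)] by linarith
qed

section \<open>Irreducibility of binomials\<close>

lemma unit_mpoly_ringI:
  fixes h :: "'k::field mpoly"
  assumes "Poly_Mapping.keys h = {0}"
  shows "h \<in> Units (mpoly_ring n)"
proof -
  define c where "c = Poly_Mapping.lookup h 0"
  have c: "c \<noteq> 0" using assms by (auto simp: c_def in_keys_iff[symmetric])
  have h: "h = Poly_Mapping.single 0 c"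
    using poly_mapping_eq_sum_single[of h] assms by (simp add: c_def)
  have "h * Poly_Mapping.single 0 (inverse c) = 1"
    using c by (simp add: h mult_single)
  moreover have "Poly_Mapping.single 0 (inverse c) \<in> carrier (mpoly_ring n)" "h \<in> carrier (mpoly_ring n)"
    by (simp_all add: h single_in_carrier)
  ultimately show ?thesis
    by (auto simp: Units_def mult.commute intro!: bexI[of _ "Poly_Mapping.single 0 (inverse c)"])
qed

text \<open>Let \<open>h\<close> be the factor that does not involve \<open>x\<^sub>a\<close>. For each \<open>j\<close> the weight
  \<open>m\<^sub>j + (v\<^sub>j - u\<^sub>j) m\<^sub>a\<close> takes the same value at \<open>u\<close> and \<open>v\<close>, hence is constant on the monomials
  of \<open>h\<close>. So \<open>h\<close> has a single monomial, which divides both \<open>u\<close> and \<open>v\<close>.\<close>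

lemma binomial_factor_const:
  fixes g h :: "'k::field mpoly"
  assumes keys: "Poly_Mapping.keys (g * h) = {u, v}"
    and coprime: "Poly_Mapping.keys u \<inter> Poly_Mapping.keys v = {}"
    and a: "Poly_Mapping.lookup u a = 1" "Poly_Mapping.lookup v a = 0"
    and h0: "\<And>m. m \<in> Poly_Mapping.keys h \<Longrightarrow> Poly_Mapping.lookup m a = 0"
  shows "Poly_Mapping.keys h = {0}"
proof -
  have nz: "g \<noteq> 0" "h \<noteq> 0" using keys by auto
  then obtain m where m: "m \<in> Poly_Mapping.keys h" by (metis ex_in_conv keys_eq_empty)
  have eq: "k = m" if k: "k \<in> Poly_Mapping.keys h" for k
  proof (rule poly_mapping_eqI)
    fix j
    define w where "w m = int (Poly_Mapping.lookup m j) +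
      (int (Poly_Mapping.lookup v j) - int (Poly_Mapping.lookup u j)) * int (Poly_Mapping.lookup m a)" for m :: monomial
    have "w k = w m"
    proof (rule weight_constant_factor[OF nz _ _ k m])
      show "w (m + k) = w m + w k" for m k
        by (simp add: w_def lookup_add algebra_simps)
      show "w m = int (Poly_Mapping.lookup v j)" if "m \<in> Poly_Mapping.keys (g * h)" for m
        using that a by (auto simp: keys w_def)
    qed
    then show "Poly_Mapping.lookup k j = Poly_Mapping.lookup m j"
      using h0[OF k] h0[OF m] by (simp add: w_def)
  qed
  with m have keys_h: "Poly_Mapping.keys h = {m}" by blast
  have "Poly_Mapping.keys m \<subseteq> Poly_Mapping.keys m'" if "m' \<in> {u, v}" for m'
  proof -
    have "m' \<in> Poly_Mapping.keys (g * h)" using that by (simp add: keys)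
    with keys_mult[of g h] have "m' \<in> {k + l |k l. k \<in> Poly_Mapping.keys g \<and> l \<in> Poly_Mapping.keys h}"
      by (rule subsetD)
    then obtain k where "m' = k + m" by (auto simp: keys_h)
    then show ?thesis by (simp add: keys_add_monomial)
  qed
  from this[of u] this[of v] have "Poly_Mapping.keys m \<subseteq> {}" using coprime by blast
  then show ?thesis using keys_h by simp
qed

text \<open>The variable \<open>a\<close> has degree one in the binomial, and degrees in
  \<open>a\<close> add up in a product. Hence one of two factors is free of it, and
  \<open>binomial_factor_const\<close> makes that factor a constant.\<close>

lemma binomial_irreducible:
  fixes f :: "'k::field mpoly"
  assumes f: "f \<in> carrier (mpoly_ring n)"
    and keys: "Poly_Mapping.keys f = {u, v}"
    and coprime: "Poly_Mapping.keys u \<inter> Poly_Mapping.keys v = {}"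
    and a: "Poly_Mapping.lookup u a = 1" "Poly_Mapping.lookup v a = 0"
  shows "ring_irreducible\<^bsub>mpoly_ring n\<^esub> f"
proof -
  interpret domain "mpoly_ring n :: 'k mpoly ring" by (rule domain_mpoly_ring)
  have free: "(\<forall>m\<in>Poly_Mapping.keys g. Poly_Mapping.lookup m a = 0) \<or>
      (\<forall>m\<in>Poly_Mapping.keys h. Poly_Mapping.lookup m a = 0)" if "f = g * h" for g h
  proof -
    have "g \<noteq> 0" "h \<noteq> 0" using keys that by auto
    then obtain p q where "p + q \<in> Poly_Mapping.keys (g * h)"
      and p: "\<And>m. m \<in> Poly_Mapping.keys g \<Longrightarrow> int (Poly_Mapping.lookup m a) \<le> int (Poly_Mapping.lookup p a)"
      and q: "\<And>m. m \<in> Poly_Mapping.keys h \<Longrightarrow> int (Poly_Mapping.lookup m a) \<le> int (Poly_Mapping.lookup q a)"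
      by (rule weight_max_mult[where w = "\<lambda>m. int (Poly_Mapping.lookup m a)"]) (auto simp: lookup_add)
    then have "p + q = u \<or> p + q = v" using keys that by auto
    then have "Poly_Mapping.lookup p a + Poly_Mapping.lookup q a \<le> 1"
      using a by (auto simp: lookup_add[symmetric])
    then have "Poly_Mapping.lookup p a = 0 \<or> Poly_Mapping.lookup q a = 0" by linarith
    then show ?thesis using p q by fastforce
  qed
  show ?thesis
  proof (rule ring_irreducibleI)
    show "f \<in> carrier (mpoly_ring n) - {\<zero>\<^bsub>mpoly_ring n\<^esub>}" using f keys by auto
    show "f \<notin> Units (mpoly_ring n)"
    proof
      assume "f \<in> Units (mpoly_ring n)"
      then obtain g where g: "f * g = 1" by (auto simp: Units_def mult.commute)
      then have nz: "f \<noteq> 0" "g \<noteq> 0" by auto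
      \<comment> \<open>A factor of \<open>1\<close> is homogeneous for the degree in
        \<open>a\<close>, whereas \<open>u\<close> and \<open>v\<close> have degrees 1 and
        0.\<close>
      have "Poly_Mapping.lookup u a = Poly_Mapping.lookup v a"
        using weight_constant_factor[of g f "\<lambda>m. int (Poly_Mapping.lookup m a)" 0 u v] nz g keys
        by (simp add: lookup_add mult.commute)
      then show False using a by simp
    qed
    fix g h assume "f = g \<otimes>\<^bsub>mpoly_ring n\<^esub> h"
    then have fgh: "f = g * h" "f = h * g" by (simp_all add: mult.commute)
    have gh: "Poly_Mapping.keys (g * h) = {u, v}" "Poly_Mapping.keys (h * g) = {u, v}"
      using keys fgh by metis+
    show "g \<in> Units (mpoly_ring n) \<or> h \<in> Units (mpoly_ring n)"
      using free[OF fgh(1)]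
    proof
      assume "\<forall>m\<in>Poly_Mapping.keys g. Poly_Mapping.lookup m a = 0"
      then have "g \<in> Units (mpoly_ring n)"
        by (intro unit_mpoly_ringI binomial_factor_const[OF gh(2) coprime a]) simp
      then show ?thesis ..
    next
      assume "\<forall>m\<in>Poly_Mapping.keys h. Poly_Mapping.lookup m a = 0"
      then have "h \<in> Units (mpoly_ring n)"
        by (intro unit_mpoly_ringI binomial_factor_const[OF gh(1) coprime a]) simp
      then show ?thesis ..
    qed
  qed
qed

section \<open>Toric ideals\<close>

text \<open>The matrix-vector product \<open>A m\<close>, which is the exponent of the Laurent
  monomial that is the image of \<open>m\<close>. The monomials with a given value form a
  fibre.\<close>

definition toric_degree :: "int mat \<Rightarrow> monomial \<Rightarrow> (nat \<Rightarrow>\<^sub>0 int)" where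
  "toric_degree A m = (\<Sum>j<dim_col A. \<Sum>i<dim_row A.
     Poly_Mapping.single i (int (Poly_Mapping.lookup m j) * A $$ (i, j)))"

lemma lookup_toric_degree:
  "Poly_Mapping.lookup (toric_degree A m) i =
     (if i < dim_row A then \<Sum>j<dim_col A. int (Poly_Mapping.lookup m j) * A $$ (i, j) else 0)"
  by (simp add: toric_degree_def lookup_sum lookup_single when_def sum.delta)

lemma toric_degree_add: "toric_degree A (u + v) = toric_degree A u + toric_degree A v"
  by (rule poly_mapping_eqI)
     (simp add: lookup_toric_degree lookup_add algebra_simps sum.distrib)

lemma prod_single_one:
  "(\<Prod>i\<in>I. Poly_Mapping.single (f i) (1::'k::field)) = Poly_Mapping.single (\<Sum>i\<in>I. f i) 1"
  for f :: "'b \<Rightarrow> 'c::comm_monoid_add"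
  by (induction I rule: infinite_finite_induct) (simp_all add: mult_single)

lemma power_single_single:
  "Poly_Mapping.single (Poly_Mapping.single i (x::int)) (1::'k::field) ^ k =
     Poly_Mapping.single (Poly_Mapping.single i (int k * x)) 1"
  by (induction k) (simp_all add: mult_single single_add[symmetric] algebra_simps)

lemma toric_map_eq:
  "toric_map A p = (\<Sum>m\<in>Poly_Mapping.keys p.
     Poly_Mapping.single (toric_degree A m) (Poly_Mapping.lookup p m))"
proof -
  have "(\<Prod>j<dim_col A. laurent_monomial A j ^ Poly_Mapping.lookup m j) =
      Poly_Mapping.single (toric_degree A m) (1 :: 'a)" for m
    unfolding laurent_monomial_def toric_degree_def prod_single_one[symmetric]
    by (simp add: prod_power_distrib power_single_single)
  then show ?thesis
    by (simp add: toric_map_def mult_single)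
qed

text \<open>Summing over a common finite set lets polynomials with different monomials be compared
  term by term, in particular \<open>p\<close>, \<open>q\<close> and \<open>p + q\<close>, where
  terms may cancel.\<close>

lemma toric_map_superset:
  assumes "finite S" "Poly_Mapping.keys p \<subseteq> S"
  shows "toric_map A p = (\<Sum>m\<in>S. Poly_Mapping.single (toric_degree A m) (Poly_Mapping.lookup p m))"
  unfolding toric_map_eq using assms
  by (intro sum.mono_neutral_left) (auto simp: in_keys_iff)

lemma toric_map_add: "toric_map A (p + q) = toric_map A p + toric_map A q"
proof -
  let ?S = "Poly_Mapping.keys p \<union> Poly_Mapping.keys q"
  have "Poly_Mapping.keys (p + q) \<subseteq> ?S" by (rule Poly_Mapping.keys_add)
  then show ?thesis
    by (simp add: toric_map_superset[of ?S] lookup_add single_add sum.distrib)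
qed

lemma toric_map_0 [simp]: "toric_map A 0 = 0"
  by (simp add: toric_map_eq)

lemma toric_map_single: "toric_map A (Poly_Mapping.single m c) = Poly_Mapping.single (toric_degree A m) c"
  by (simp add: toric_map_superset[of "{m}"])

lemma toric_map_sum: "toric_map A (sum f S) = (\<Sum>x\<in>S. toric_map A (f x))"
  by (induction S rule: infinite_finite_induct) (simp_all add: toric_map_add)

lemma toric_map_mult: "toric_map A (p * q) = toric_map A p * toric_map A q"
proof -
  have "p * q = (\<Sum>m\<in>Poly_Mapping.keys p. \<Sum>k\<in>Poly_Mapping.keys q.
      Poly_Mapping.single (m + k) (Poly_Mapping.lookup p m * Poly_Mapping.lookup q k))"
    by (subst poly_mapping_eq_sum_single[of p, symmetric], subst poly_mapping_eq_sum_single[of q, symmetric])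
       (simp add: sum_product mult_single)
  then show ?thesis
    by (simp add: toric_map_sum toric_map_single toric_degree_add)
       (simp add: toric_map_eq sum_product mult_single)
qed

lemma toric_map_uminus: "toric_map A (- p) = - toric_map A p"
  using toric_map_add[of A p "- p"] by (simp add: add_eq_0_iff)

lemma ideal_toric_ideal: "ideal (toric_ideal A :: 'k::field mpoly set) (mpoly_ring (dim_col A))"
proof -
  interpret cring "mpoly_ring (dim_col A) :: 'k mpoly ring" by (rule cring_mpoly_ring)
  show ?thesis
  proof (rule mpoly_idealI)
    fix p q :: "'k mpoly" assume pq: "p \<in> toric_ideal A" "q \<in> toric_ideal A"
    then have "p \<oplus>\<^bsub>mpoly_ring (dim_col A)\<^esub> q \<in> carrier (mpoly_ring (dim_col A))"
      by (intro a_closed) (auto simp: toric_ideal_def)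
    with pq show "p + q \<in> toric_ideal A" by (simp add: toric_ideal_def toric_map_add)
  next
    fix p q :: "'k mpoly" assume pq: "p \<in> toric_ideal A" "q \<in> carrier (mpoly_ring (dim_col A))"
    then have "q \<otimes>\<^bsub>mpoly_ring (dim_col A)\<^esub> p \<in> carrier (mpoly_ring (dim_col A))"
      by (intro m_closed) (auto simp: toric_ideal_def)
    with pq show "q * p \<in> toric_ideal A" by (simp add: toric_ideal_def toric_map_mult)
  qed (auto simp: toric_ideal_def carrier_mpoly_ring)
qed

section \<open>Binomials span the toric ideal\<close>

lemma binomial_in_carrier_iff:
  assumes "u \<noteq> v"
  shows "mono_poly u - mono_poly v \<in> carrier (mpoly_ring n :: 'k::field mpoly ring) \<longleftrightarrow>
    Poly_Mapping.keys u \<subseteq> {..<n} \<and> Poly_Mapping.keys v \<subseteq> {..<n}"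
  by (simp add: carrier_mpoly_ring keys_binomial[OF assms])

lemma toric_map_binomial:
  "toric_map A (mono_poly u - mono_poly v :: 'k::field mpoly) = 0 \<longleftrightarrow> toric_degree A u = toric_degree A v"
proof -
  have "toric_map A (mono_poly u - mono_poly v :: 'k mpoly) =
      Poly_Mapping.single (toric_degree A u) 1 - Poly_Mapping.single (toric_degree A v) 1"
    using toric_map_add[of A "mono_poly u :: 'k mpoly" "- mono_poly v"]
    by (simp add: toric_map_uminus toric_map_single mono_poly_def)
  moreover have "Poly_Mapping.single (toric_degree A u) (1::'k) = Poly_Mapping.single (toric_degree A v) 1
      \<longleftrightarrow> toric_degree A u = toric_degree A v"
    by (metis keys_single singleton_inject zero_neq_one)
  ultimately show ?thesis by simp
qed

lemma binomial_in_toric_ideal_iff: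
  assumes "u \<noteq> v"
  shows "mono_poly u - mono_poly v \<in> (toric_ideal A :: 'k::field mpoly set) \<longleftrightarrow>
    Poly_Mapping.keys u \<subseteq> {..<dim_col A} \<and> Poly_Mapping.keys v \<subseteq> {..<dim_col A} \<and>
    toric_degree A u = toric_degree A v"
  by (simp add: toric_ideal_def toric_map_binomial binomial_in_carrier_iff[OF assms])

text \<open>Induction on the number of terms. In each multidegree the coefficients of
  \<open>p\<close> sum to zero, so a monomial \<open>m\<close> of \<open>p\<close> has a partner
  \<open>k\<close> in the same fibre. Subtracting the multiple \<open>b\<close> of
  \<open>m - k\<close> removes \<open>m\<close> and introduces no new monomial.\<close>

lemma toric_ideal_subset:
  fixes J :: "'k::field mpoly set"
  assumes J: "ideal J (mpoly_ring (dim_col A))"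
    and binomials: "\<And>u v. \<lbrakk>Poly_Mapping.keys u \<subseteq> {..<dim_col A}; Poly_Mapping.keys v \<subseteq> {..<dim_col A};
      toric_degree A u = toric_degree A v\<rbrakk> \<Longrightarrow> mono_poly u - mono_poly v \<in> J"
  shows "toric_ideal A \<subseteq> J"
proof
  fix p :: "'k mpoly" assume "p \<in> toric_ideal A"
  then show "p \<in> J"
  proof (induction "card (Poly_Mapping.keys p)" arbitrary: p rule: less_induct)
    case less
    show ?case
    proof (cases "p = 0")
      case True
      then show ?thesis using mpoly_idealD(2)[OF J] by simp
    next
      case False
      then obtain m where m: "m \<in> Poly_Mapping.keys p" by (metis ex_in_conv keys_eq_empty)
      have p: "p \<in> carrier (mpoly_ring (dim_col A))" and "toric_map A p = 0"
        using less.prems by (auto simp: toric_ideal_def)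
      then have "0 = Poly_Mapping.lookup (toric_map A p) (toric_degree A m)" by simp
      also have "\<dots> = (\<Sum>k\<in>Poly_Mapping.keys p. Poly_Mapping.lookup p k when toric_degree A k = toric_degree A m)"
        by (simp add: toric_map_eq lookup_sum lookup_single)
      also have "\<dots> = Poly_Mapping.lookup p m +
          (\<Sum>k\<in>Poly_Mapping.keys p - {m}. Poly_Mapping.lookup p k when toric_degree A k = toric_degree A m)"
        using m by (simp add: sum.remove[of _ m])
      finally have "(\<Sum>k\<in>Poly_Mapping.keys p - {m}. Poly_Mapping.lookup p k when toric_degree A k = toric_degree A m) \<noteq> 0"
        using m by (auto simp: in_keys_iff)
      then obtain k where k: "k \<in> Poly_Mapping.keys p" "k \<noteq> m" "toric_degree A k = toric_degree A m"
        by (rule sum.not_neutral_contains_not_neutral) (auto simp: when_def split: if_splits)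
      define b :: "'k mpoly" where
        "b = Poly_Mapping.single 0 (Poly_Mapping.lookup p m) * (mono_poly m - mono_poly k)"
      have mk: "Poly_Mapping.keys m \<subseteq> {..<dim_col A}" "Poly_Mapping.keys k \<subseteq> {..<dim_col A}"
        using p m k by (auto simp: carrier_mpoly_ring)
      have const: "Poly_Mapping.single 0 (Poly_Mapping.lookup p m) \<in> carrier (mpoly_ring (dim_col A))"
        by (simp add: single_in_carrier)
      have bJ: "b \<in> J" unfolding b_def
        using binomials[OF mk k(3)[symmetric]] const by (rule mpoly_idealD(4)[OF J])
      have "mono_poly m - mono_poly k \<in> (toric_ideal A :: 'k mpoly set)"
        using k mk by (subst binomial_in_toric_ideal_iff) auto
      then have bI: "b \<in> toric_ideal A" unfolding b_def
        using const by (rule mpoly_idealD(4)[OF ideal_toric_ideal])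
      have lookup_b: "Poly_Mapping.lookup b l = (if l = m then Poly_Mapping.lookup p m
          else if l = k then - Poly_Mapping.lookup p m else 0)" for l
        using k(2) by (auto simp: b_def mono_poly_def algebra_simps mult_single lookup_minus lookup_single when_def)
      have "Poly_Mapping.keys (p + - b) \<subseteq> Poly_Mapping.keys p - {m}"
        using k by (auto simp: in_keys_iff lookup_minus lookup_b split: if_splits)
      then have "card (Poly_Mapping.keys (p + - b)) < card (Poly_Mapping.keys p)"
        using m by (intro psubset_card_mono) auto
      moreover have "p + - b \<in> toric_ideal A"
        using less.prems bI mpoly_idealD(3,5)[OF ideal_toric_ideal] by blast
      ultimately have "p + - b \<in> J" by (rule less.hyps)
      then have "(p + - b) + b \<in> J" using bJ by (rule mpoly_idealD(3)[OF J])
      then show ?thesis by simp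
    qed
  qed
qed

section \<open>Connectivity of the fibres\<close>

abbreviation var :: "nat \<Rightarrow> monomial" where
  "var j \<equiv> Poly_Mapping.single j (Suc 0)"

lemma monomial_split_var:
  assumes "j \<in> Poly_Mapping.keys (u :: monomial)"
  obtains w where "u = var j + w"
proof
  show "u = var j + (u - var j)"
    using assms by (intro poly_mapping_eqI) (auto simp: lookup_add lookup_minus lookup_single when_def in_keys_iff)
qed

lemma monomial_size_0:
  assumes "Poly_Mapping.keys (w :: monomial) \<subseteq> {..<n}" "(\<Sum>j<n. Poly_Mapping.lookup w j) = 0"
  shows "w = 0"
proof (rule poly_mapping_eqI)
  fix j
  show "Poly_Mapping.lookup w j = Poly_Mapping.lookup 0 j"
    using assms by (cases "j < n") (auto simp: in_keys_iff)
qed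

text \<open>The columns are the lattice points of the dilated simplex of degree \<open>r\<close> whose coordinates are
  at most \<open>c\<close>: \<open>c = 1\<close> gives \<open>SV\<close> and \<open>c = r\<close> gives \<open>V\<close>.\<close>

locale truncated_simplex =
  fixes A :: "int mat" and c r :: int
  assumes r_pos: "0 < r"
    and entry: "\<lbrakk>i < dim_row A; j < dim_col A\<rbrakk> \<Longrightarrow> 0 \<le> A $$ (i, j) \<and> A $$ (i, j) \<le> c"
    and col_sum: "j < dim_col A \<Longrightarrow> (\<Sum>i<dim_row A. A $$ (i, j)) = r"
    and col_inj: "\<lbrakk>j < dim_col A; k < dim_col A; \<And>i. i < dim_row A \<Longrightarrow> A $$ (i, j) = A $$ (i, k)\<rbrakk> \<Longrightarrow> j = k"
    and col_ex: "\<lbrakk>\<And>i. i < dim_row A \<Longrightarrow> 0 \<le> \<alpha> i \<and> \<alpha> i \<le> c; (\<Sum>i<dim_row A. \<alpha> i) = r\<rbrakk>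
      \<Longrightarrow> \<exists>j<dim_col A. \<forall>i<dim_row A. A $$ (i, j) = \<alpha> i"
begin

lemma lookup_toric_degree_var:
  "\<lbrakk>j < dim_col A; i < dim_row A\<rbrakk> \<Longrightarrow> Poly_Mapping.lookup (toric_degree A (var j)) i = A $$ (i, j)"
  by (simp add: lookup_toric_degree lookup_single when_def if_distrib if_distribR sum.delta cong: if_cong)

lemma toric_degree_quadric_iff:
  assumes "a < dim_col A" "b < dim_col A" "a' < dim_col A" "b' < dim_col A"
  shows "toric_degree A (var a + var b) = toric_degree A (var a' + var b') \<longleftrightarrow>
    (\<forall>i<dim_row A. A $$ (i, a) + A $$ (i, b) = A $$ (i, a') + A $$ (i, b'))"
proof
  assume eq: "toric_degree A (var a + var b) = toric_degree A (var a' + var b')"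
  show "\<forall>i<dim_row A. A $$ (i, a) + A $$ (i, b) = A $$ (i, a') + A $$ (i, b')"
  proof (intro allI impI)
    fix i assume "i < dim_row A"
    with arg_cong[OF eq, of "\<lambda>f. Poly_Mapping.lookup f i"] assms
    show "A $$ (i, a) + A $$ (i, b) = A $$ (i, a') + A $$ (i, b')"
      by (simp add: toric_degree_add lookup_add lookup_toric_degree_var)
  qed
next
  assume eq: "\<forall>i<dim_row A. A $$ (i, a) + A $$ (i, b) = A $$ (i, a') + A $$ (i, b')"
  show "toric_degree A (var a + var b) = toric_degree A (var a' + var b')"
  proof (rule poly_mapping_eqI)
    fix i
    show "Poly_Mapping.lookup (toric_degree A (var a + var b)) i =
        Poly_Mapping.lookup (toric_degree A (var a' + var b')) i"
      using assms eq
      by (cases "i < dim_row A")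
         (auto simp: toric_degree_add lookup_add lookup_toric_degree_var, simp add: lookup_toric_degree)
  qed
qed

text \<open>Every column sums to \<open>r\<close>. Since \<open>r\<close> is positive, the ordinary
  degree of a monomial can be recovered from its multidegree and is therefore constant on
  fibres.\<close>

lemma toric_degree_size:
  "(\<Sum>i<dim_row A. Poly_Mapping.lookup (toric_degree A u) i) =
     r * int (\<Sum>j<dim_col A. Poly_Mapping.lookup u j)"
proof -
  have "(\<Sum>i<dim_row A. Poly_Mapping.lookup (toric_degree A u) i) =
      (\<Sum>j<dim_col A. \<Sum>i<dim_row A. int (Poly_Mapping.lookup u j) * A $$ (i, j))"
    by (simp add: lookup_toric_degree sum.swap[of _ "{..<dim_col A}"])
  also have "\<dots> = (\<Sum>j<dim_col A. int (Poly_Mapping.lookup u j) * r)"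
    by (simp add: sum_distrib_left[symmetric] col_sum)
  finally show ?thesis by (simp add: sum_distrib_left mult.commute)
qed

lemma toric_degree_eq_size:
  "toric_degree A u = toric_degree A v \<Longrightarrow>
    (\<Sum>j<dim_col A. Poly_Mapping.lookup u j) = (\<Sum>j<dim_col A. Poly_Mapping.lookup v j)"
  using toric_degree_size[of u] toric_degree_size[of v] r_pos by (simp flip: of_nat_sum)

text \<open>The l1 distance between two columns, the measure that exchange moves decrease.\<close>

definition col_dist :: "nat \<Rightarrow> nat \<Rightarrow> int" where
  "col_dist a b = (\<Sum>i<dim_row A. \<bar>A $$ (i, a) - A $$ (i, b)\<bar>)"

lemma col_dist_commute: "col_dist a b = col_dist b a"
  by (simp add: col_dist_def abs_minus_commute)

lemma col_dist_nonneg: "0 \<le> col_dist a b"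
  by (simp add: col_dist_def sum_nonneg)

text \<open>Moving a unit from coordinate \<open>j\<close> to coordinate \<open>i\<close> preserves
  the sum, and the two strict inequalities keep the entries between 0 and \<open>c\<close>, so
  \<open>col_ex\<close> provides the column.\<close>

lemma shifted_column:
  assumes "i < dim_row A" "j < dim_row A" "i \<noteq> j" "a < dim_col A" "A $$ (i, a) < c" "0 < A $$ (j, a)"
  obtains a' where "a' < dim_col A"
    "\<And>k. k < dim_row A \<Longrightarrow> A $$ (k, a') = A $$ (k, a) + (if k = i then 1 else 0) - (if k = j then 1 else 0)"
proof -
  let ?\<alpha> = "\<lambda>k. A $$ (k, a) + (if k = i then 1 else 0) - (if k = j then 1 else 0)"
  have "(\<Sum>k<dim_row A. ?\<alpha> k) = r"
    using assms by (simp add: sum.distrib sum_subtractf col_sum)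
  moreover have "0 \<le> ?\<alpha> k \<and> ?\<alpha> k \<le> c" if "k < dim_row A" for k
    using entry[OF that assms(4)] assms by auto
  ultimately show thesis using that col_ex[of ?\<alpha>] by blast
qed

end

section \<open>Congruence of monomials modulo an ideal containing the toric quadrics\<close>

locale quadric_ideal = truncated_simplex A c r for A c r +
  fixes J :: "'k::field mpoly set"
  assumes ideal_J: "ideal J (mpoly_ring (dim_col A))"
    and quadric: "\<lbrakk>a < dim_col A; b < dim_col A; a' < dim_col A; b' < dim_col A;
      toric_degree A (var a + var b) = toric_degree A (var a' + var b')\<rbrakk>
      \<Longrightarrow> mono_poly (var a + var b) - mono_poly (var a' + var b') \<in> J"
begin

text \<open>Reachability by moves is expressed as congruence modulo \<open>J\<close>. The conditions
  on variables and multidegree keep the relation inside one fibre of the ring in question.\<close>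

definition toric_cong :: "monomial \<Rightarrow> monomial \<Rightarrow> bool" where
  "toric_cong u v \<longleftrightarrow> Poly_Mapping.keys u \<subseteq> {..<dim_col A} \<and> Poly_Mapping.keys v \<subseteq> {..<dim_col A} \<and>
     toric_degree A u = toric_degree A v \<and> mono_poly u - mono_poly v \<in> J"

lemma toric_cong_refl: "Poly_Mapping.keys u \<subseteq> {..<dim_col A} \<Longrightarrow> toric_cong u u"
  using mpoly_idealD(2)[OF ideal_J] by (simp add: toric_cong_def)

lemma toric_cong_sym: "toric_cong u v \<Longrightarrow> toric_cong v u"
  using mpoly_idealD(5)[OF ideal_J, of "mono_poly u - mono_poly v"] by (simp add: toric_cong_def)

lemma toric_cong_trans: "toric_cong u v \<Longrightarrow> toric_cong v w \<Longrightarrow> toric_cong u w"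
  using mpoly_idealD(3)[OF ideal_J, of "mono_poly u - mono_poly v" "mono_poly v - mono_poly w"]
  by (simp add: toric_cong_def)

lemma toric_cong_add:
  assumes "toric_cong u v" "Poly_Mapping.keys w \<subseteq> {..<dim_col A}"
  shows "toric_cong (u + w) (v + w)"
proof -
  have "mono_poly w * (mono_poly u - mono_poly v) \<in> J"
    using assms by (intro mpoly_idealD(4)[OF ideal_J]) (auto simp: toric_cong_def mono_poly_def single_in_carrier)
  then show ?thesis
    using assms by (simp add: toric_cong_def keys_add_monomial toric_degree_add mono_poly_add algebra_simps)
qed

text \<open>Column \<open>a\<close> gives a unit of coordinate \<open>j\<close> to \<open>b\<close>
  and receives one of coordinate \<open>i\<close>. The sum of the two columns is unchanged, so this
  is a quadric move, and \<open>a\<close> comes closer to \<open>e\<close> in both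
  coordinates.\<close>

lemma exchange:
  assumes u: "u = var a + (var b + w)" and u_keys: "Poly_Mapping.keys u \<subseteq> {..<dim_col A}"
    and e: "e < dim_col A" and ij: "i < dim_row A" "j < dim_row A"
    and "A $$ (i, a) < A $$ (i, e)" "A $$ (j, e) < A $$ (j, a)" "A $$ (j, b) < A $$ (i, b)"
  shows "\<exists>u' a'. toric_cong u u' \<and> a' \<in> Poly_Mapping.keys u' \<and> col_dist a' e < col_dist a e"
proof -
  have ab: "a < dim_col A" "b < dim_col A" and w: "Poly_Mapping.keys w \<subseteq> {..<dim_col A}"
    using u_keys by (auto simp: u keys_add_monomial)
  have "i \<noteq> j" using assms by auto
  \<comment> \<open>Room for both shifts: an entry strictly below another entry is below
    \<open>c\<close>, and one strictly above another entry is positive.\<close>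
  moreover have "A $$ (i, a) < c" "0 < A $$ (j, a)" "A $$ (j, b) < c" "0 < A $$ (i, b)"
    using assms entry[OF ij(1) e] entry[OF ij(2) e] entry[OF ij(1) ab(2)] entry[OF ij(2) ab(2)] by linarith+
  ultimately obtain a' b' where
      a': "a' < dim_col A" "\<And>k. k < dim_row A \<Longrightarrow> A $$ (k, a') = A $$ (k, a) + (if k = i then 1 else 0) - (if k = j then 1 else 0)"
    and b': "b' < dim_col A" "\<And>k. k < dim_row A \<Longrightarrow> A $$ (k, b') = A $$ (k, b) + (if k = j then 1 else 0) - (if k = i then 1 else 0)"
    using shifted_column[OF ij _ ab(1)] shifted_column[OF ij(2,1) _ ab(2)] by metis
  have deg: "toric_degree A (var a + var b) = toric_degree A (var a' + var b')"
    unfolding toric_degree_quadric_iff[OF ab a'(1) b'(1)] using a'(2) b'(2) by auto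
  have "toric_cong (var a + var b) (var a' + var b')"
    using quadric[OF ab a'(1) b'(1) deg] ab a'(1) b'(1) deg by (simp add: toric_cong_def keys_add_monomial)
  from toric_cong_add[OF this w] have "toric_cong u (var a' + var b' + w)"
    by (simp add: u add.assoc)
  moreover have "a' \<in> Poly_Mapping.keys (var a' + var b' + w)" by (simp add: keys_add_monomial)
  moreover have "col_dist a' e < col_dist a e"
    unfolding col_dist_def
  proof (rule sum_strict_mono_ex1)
    show "\<forall>k\<in>{..<dim_row A}. \<bar>A $$ (k, a') - A $$ (k, e)\<bar> \<le> \<bar>A $$ (k, a) - A $$ (k, e)\<bar>"
      using a'(2) assms \<open>i \<noteq> j\<close> by auto
    show "\<exists>k\<in>{..<dim_row A}. \<bar>A $$ (k, a') - A $$ (k, e)\<bar> < \<bar>A $$ (k, a) - A $$ (k, e)\<bar>"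
      using a'(2)[OF ij(1)] assms \<open>i \<noteq> j\<close> by (intro bexI[of _ i]) auto
  qed simp
  ultimately show ?thesis by blast
qed

text \<open>The partner column that \<open>exchange\<close> requires may be missing from
  \<open>u\<close>. In that case the equality of the multidegrees provides one in \<open>v\<close>,
  and \<open>e\<close> is moved towards \<open>a\<close> instead.\<close>

lemma exchange_either_side:
  assumes u: "u = var a + x" and v: "v = var e + y"
    and keys: "Poly_Mapping.keys u \<subseteq> {..<dim_col A}" "Poly_Mapping.keys v \<subseteq> {..<dim_col A}"
    and deg: "toric_degree A u = toric_degree A v" and "a \<noteq> e"
  shows "(\<exists>u' a'. toric_cong u u' \<and> a' \<in> Poly_Mapping.keys u' \<and> col_dist a' e < col_dist a e) \<or>
    (\<exists>v' e'. toric_cong v v' \<and> e' \<in> Poly_Mapping.keys v' \<and> col_dist a e' < col_dist a e)"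
proof -
  have ae: "a < dim_col A" "e < dim_col A"
    using keys by (auto simp: u v keys_add_monomial)
  obtain i0 where i0: "i0 < dim_row A" "A $$ (i0, a) \<noteq> A $$ (i0, e)"
    using col_inj[OF ae] \<open>a \<noteq> e\<close> by blast
  have sums: "(\<Sum>k<dim_row A. A $$ (k, a)) = (\<Sum>k<dim_row A. A $$ (k, e))"
    using col_sum ae by simp
  \<comment> \<open>Distinct columns with the same sum differ in both directions.\<close>
  have "\<exists>i<dim_row A. A $$ (i, a) < A $$ (i, e)"
  proof (rule ccontr)
    assume "\<not> ?thesis"
    then have "(\<Sum>k<dim_row A. A $$ (k, e)) < (\<Sum>k<dim_row A. A $$ (k, a))"
      using i0 by (intro sum_strict_mono_ex1) force+
    then show False using sums by simp
  qed
  then obtain i where i: "i < dim_row A" "A $$ (i, a) < A $$ (i, e)" by blast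
  have "\<exists>j<dim_row A. A $$ (j, e) < A $$ (j, a)"
  proof (rule ccontr)
    assume "\<not> ?thesis"
    then have "(\<Sum>k<dim_row A. A $$ (k, a)) < (\<Sum>k<dim_row A. A $$ (k, e))"
      using i0 by (intro sum_strict_mono_ex1) force+
    then show False using sums by simp
  qed
  then obtain j where j: "j < dim_row A" "A $$ (j, e) < A $$ (j, a)" by blast
  \<comment> \<open>The degree in \<open>i\<close> minus the degree in \<open>j\<close> is additive
    and agrees on \<open>u\<close> and \<open>v\<close>. It is smaller on \<open>a\<close> than on
    \<open>e\<close>, hence larger on the remainder \<open>x\<close> than on \<open>y\<close>. So it
    is positive on \<open>x\<close> or negative on \<open>y\<close>, and some column there has the
    same sign.\<close>
  let ?d = "\<lambda>w. Poly_Mapping.lookup (toric_degree A w) i - Poly_Mapping.lookup (toric_degree A w) j"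
  have d: "?d w = (\<Sum>k<dim_col A. int (Poly_Mapping.lookup w k) * (A $$ (i, k) - A $$ (j, k)))" for w
    using i(1) j(1) by (simp add: lookup_toric_degree sum_subtractf[symmetric] algebra_simps)
  have "?d u = A $$ (i, a) - A $$ (j, a) + ?d x" "?d v = A $$ (i, e) - A $$ (j, e) + ?d y"
    using ae i(1) j(1) by (simp_all add: u v toric_degree_add lookup_add lookup_toric_degree_var)
  then have "?d y < ?d x" using deg i j by simp
  have "(\<exists>b\<in>Poly_Mapping.keys x. A $$ (j, b) < A $$ (i, b)) \<or> (\<exists>b\<in>Poly_Mapping.keys y. A $$ (i, b) < A $$ (j, b))"
  proof (rule ccontr)
    assume none: "\<not> ?thesis"
    have "?d x \<le> 0" unfolding d
    proof (rule sum_nonpos)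
      fix k
      show "int (Poly_Mapping.lookup x k) * (A $$ (i, k) - A $$ (j, k)) \<le> 0"
      proof (cases "k \<in> Poly_Mapping.keys x")
        case True
        then have "A $$ (i, k) \<le> A $$ (j, k)" using none by force
        then show ?thesis by (simp add: mult_le_0_iff)
      qed (simp add: in_keys_iff)
    qed
    moreover have "0 \<le> ?d y" unfolding d
    proof (rule sum_nonneg)
      fix k
      show "0 \<le> int (Poly_Mapping.lookup y k) * (A $$ (i, k) - A $$ (j, k))"
      proof (cases "k \<in> Poly_Mapping.keys y")
        case True
        then have "A $$ (j, k) \<le> A $$ (i, k)" using none by force
        then show ?thesis by simp
      qed (simp add: in_keys_iff)
    qed
    ultimately show False using \<open>?d y < ?d x\<close> by linarith
  qed
  then show ?thesis
  proof
    assume "\<exists>b\<in>Poly_Mapping.keys x. A $$ (j, b) < A $$ (i, b)"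
    then obtain b w where b: "x = var b + w" "A $$ (j, b) < A $$ (i, b)"
      by (metis monomial_split_var)
    show ?thesis
      using exchange[OF u[unfolded b(1)] keys(1) ae(2) i(1) j(1) i(2) j(2) b(2)] by blast
  next
    \<comment> \<open>Here \<open>v\<close> is changed: \<open>a\<close> and \<open>e\<close> swap
      roles, and so do \<open>i\<close> and \<open>j\<close>.\<close>
    assume "\<exists>b\<in>Poly_Mapping.keys y. A $$ (i, b) < A $$ (j, b)"
    then obtain b w where b: "y = var b + w" "A $$ (i, b) < A $$ (j, b)"
      by (metis monomial_split_var)
    show ?thesis
      using exchange[OF v[unfolded b(1)] keys(2) ae(1) j(1) i(1) j(2) i(2) b(2)]
      by (auto simp: col_dist_commute[of a])
  qed
qed

lemma common_variable:
  assumes keys: "Poly_Mapping.keys u \<subseteq> {..<dim_col A}" "Poly_Mapping.keys v \<subseteq> {..<dim_col A}"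
    and deg: "toric_degree A u = toric_degree A v" and nz: "u \<noteq> 0" "v \<noteq> 0"
  obtains a x y where "toric_cong u (var a + x)" "toric_cong v (var a + y)"
proof -
  \<comment> \<open>A pair of monomials congruent to \<open>u\<close> and \<open>v\<close>, with a
    marked column in each. A quadruple with the least distance between the marked columns exists,
    and any exchange would contradict its choice.\<close>
  define Q where "Q = (\<lambda>(u', v', a, e). toric_cong u u' \<and> toric_cong v v' \<and>
    a \<in> Poly_Mapping.keys u' \<and> e \<in> Poly_Mapping.keys v')"
  define f where "f = (\<lambda>(u' :: monomial, v' :: monomial, a, e). nat (col_dist a e))"
  obtain a e where "a \<in> Poly_Mapping.keys u" "e \<in> Poly_Mapping.keys v"
    using nz by (metis ex_in_conv keys_eq_empty)
  then have "Q (u, v, a, e)"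
    using keys by (simp add: Q_def toric_cong_refl)
  then obtain z where z: "Q z" "\<And>z'. Q z' \<Longrightarrow> f z \<le> f z'"
    using ex_has_least_nat[of Q _ f] by metis
  obtain u' v' a e where z_eq: "z = (u', v', a, e)" by (cases z)
  have uv: "toric_cong u u'" "toric_cong v v'" "a \<in> Poly_Mapping.keys u'" "e \<in> Poly_Mapping.keys v'"
    using z(1) by (auto simp: z_eq Q_def)
  obtain x y where x: "u' = var a + x" and y: "v' = var e + y"
    using uv(3,4) by (metis monomial_split_var)
  have "a = e"
  proof (rule ccontr)
    assume "a \<noteq> e"
    moreover have "toric_degree A u' = toric_degree A v'" "Poly_Mapping.keys u' \<subseteq> {..<dim_col A}"
      "Poly_Mapping.keys v' \<subseteq> {..<dim_col A}"
      using uv(1,2) deg by (auto simp: toric_cong_def)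
    ultimately consider u'' a' where "toric_cong u' u''" "a' \<in> Poly_Mapping.keys u''" "col_dist a' e < col_dist a e"
      | v'' e' where "toric_cong v' v''" "e' \<in> Poly_Mapping.keys v''" "col_dist a e' < col_dist a e"
      using exchange_either_side[OF x y] by blast
    then show False
    proof cases
      case 1
      then have "Q (u'', v', a', e)" using uv toric_cong_trans[OF uv(1) 1(1)] by (simp add: Q_def)
      from z(2)[OF this] 1(3) col_dist_nonneg[of a' e] show False by (simp add: f_def z_eq)
    next
      case 2
      then have "Q (u', v'', a, e')" using uv toric_cong_trans[OF uv(2) 2(1)] by (simp add: Q_def)
      from z(2)[OF this] 2(3) col_dist_nonneg[of a e'] show False by (simp add: f_def z_eq)
    qed
  qed
  then show thesis using that uv(1,2) x y by blast
qed

text \<open>Induction on the degree. A shared variable is cancelled, the remainders have equal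
  multidegree and smaller degree, and their congruence is multiplied by the variable again.\<close>

lemma fibre_toric_cong:
  assumes "Poly_Mapping.keys u \<subseteq> {..<dim_col A}" "Poly_Mapping.keys v \<subseteq> {..<dim_col A}"
    and "toric_degree A u = toric_degree A v"
  shows "toric_cong u v"
  using assms
proof (induction "\<Sum>j<dim_col A. Poly_Mapping.lookup u j" arbitrary: u v rule: less_induct)
  case less
  note size = toric_degree_eq_size[OF less.prems(3)]
  show ?case
  proof (cases "u = 0 \<or> v = 0")
    case True
    then have "u = 0" "v = 0" using monomial_size_0 less.prems(1,2) size by auto
    then show ?thesis by (simp add: toric_cong_refl)
  next
    case False
    then obtain a x y where xy: "toric_cong u (var a + x)" "toric_cong v (var a + y)"
      using common_variable[OF less.prems] by blast
    have keys: "a < dim_col A" "Poly_Mapping.keys x \<subseteq> {..<dim_col A}" "Poly_Mapping.keys y \<subseteq> {..<dim_col A}"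
      using xy by (auto simp: toric_cong_def keys_add_monomial)
    have "(\<Sum>j<dim_col A. Poly_Mapping.lookup u j) = (\<Sum>j<dim_col A. Poly_Mapping.lookup (var a + x) j)"
      using xy(1) by (intro toric_degree_eq_size) (simp add: toric_cong_def)
    also have "\<dots> = Suc (\<Sum>j<dim_col A. Poly_Mapping.lookup x j)"
      using keys(1) by (simp add: lookup_add sum.distrib lookup_single when_def)
    finally have "(\<Sum>j<dim_col A. Poly_Mapping.lookup x j) < (\<Sum>j<dim_col A. Poly_Mapping.lookup u j)" by simp
    moreover have "toric_degree A x = toric_degree A y"
      using xy less.prems(3) by (simp add: toric_cong_def toric_degree_add)
    ultimately have "toric_cong x y" using less.hyps keys by blast
    then have "toric_cong (var a + x) (var a + y)"
      using toric_cong_add[of x y "var a"] keys(1) by (simp add: add.commute)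
    then show ?thesis using xy toric_cong_trans toric_cong_sym by blast
  qed
qed

lemma toric_ideal_subset_J: "toric_ideal A \<subseteq> J"
  using fibre_toric_cong by (intro toric_ideal_subset[OF ideal_J]) (auto simp: toric_cong_def)

end

section \<open>Quadratic circuits\<close>

lemma supp_binomial:
  "u \<noteq> v \<Longrightarrow> supp (mono_poly u - mono_poly v :: 'k::field mpoly) = Poly_Mapping.keys u \<union> Poly_Mapping.keys v"
  by (simp add: supp_def keys_binomial)

lemma squarefree_var_add: "a \<noteq> b \<Longrightarrow> squarefree_monomial (var a + var b)"
  by (simp add: squarefree_monomial_def lookup_add lookup_single when_def)

section \<open>Affine relations between few columns\<close>

context truncated_simplex
begin

text \<open>The exponent differences of a toric binomial are the coefficients of an affine relation
  between columns: they annihilate every row, and they sum to zero because both monomials have the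
  same degree.\<close>

lemma binomial_relation:
  fixes u v :: monomial
  defines "w \<equiv> \<lambda>j. int (Poly_Mapping.lookup u j) - int (Poly_Mapping.lookup v j)"
  assumes deg: "toric_degree A u = toric_degree A v"
    and S: "S \<subseteq> {..<dim_col A}" "Poly_Mapping.keys u \<union> Poly_Mapping.keys v \<subseteq> S"
  shows "(\<Sum>j\<in>S. w j) = 0" and "i < dim_row A \<Longrightarrow> (\<Sum>j\<in>S. w j * A $$ (i, j)) = 0"
proof -
  have off: "w j = 0" if "j \<notin> S" for j
  proof -
    have "j \<notin> Poly_Mapping.keys u" "j \<notin> Poly_Mapping.keys v" using that S(2) by auto
    then show ?thesis by (simp add: w_def in_keys_iff)
  qed
  have "(\<Sum>j<dim_col A. w j) = 0"
    using toric_degree_eq_size[OF deg] by (simp add: w_def sum_subtractf flip: of_nat_sum)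
  also have "(\<Sum>j<dim_col A. w j) = (\<Sum>j\<in>S. w j)"
    using S(1) off by (intro sum.mono_neutral_right) auto
  finally show "(\<Sum>j\<in>S. w j) = 0" .
  assume i: "i < dim_row A"
  have "(\<Sum>j<dim_col A. w j * A $$ (i, j)) = 0"
    using arg_cong[OF deg, of "\<lambda>f. Poly_Mapping.lookup f i"] i
    by (simp add: lookup_toric_degree w_def algebra_simps sum_subtractf)
  also have "(\<Sum>j<dim_col A. w j * A $$ (i, j)) = (\<Sum>j\<in>S. w j * A $$ (i, j))"
    using S(1) off by (intro sum.mono_neutral_right) auto
  finally show "(\<Sum>j\<in>S. w j * A $$ (i, j)) = 0" .
qed

text \<open>With \<open>y = - x\<close> the relation says that \<open>x\<close> times the difference
  of two distinct columns vanishes.\<close>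

lemma two_columns_independent:
  assumes "a < dim_col A" "b < dim_col A" "a \<noteq> b"
    and "x + y = 0" "\<And>i. i < dim_row A \<Longrightarrow> x * A $$ (i, a) + y * A $$ (i, b) = 0"
  shows "x = 0 \<and> y = 0"
proof (rule ccontr)
  assume "\<not> ?thesis"
  then have x: "x \<noteq> 0" "y = - x" using assms(4) by auto
  have "A $$ (i, a) = A $$ (i, b)" if "i < dim_row A" for i
  proof -
    have "x * (A $$ (i, a) - A $$ (i, b)) = 0" using assms(5)[OF that] x(2) by (simp add: algebra_simps)
    then show ?thesis using x(1) by simp
  qed
  then show False using col_inj assms(1-3) by blast
qed

text \<open>Four distinct collinear points differ pairwise in every coordinate that is not constant on
  the line, so they cannot all have entries in \<open>{0, 1, 2}\<close>.\<close>

lemma three_of_quadric_independent: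
  assumes c: "c \<le> 2"
    and cols: "a < dim_col A" "b < dim_col A" "e < dim_col A" "f < dim_col A"
    and ne: "a \<noteq> b" "a \<noteq> e" "b \<noteq> e" "e \<noteq> f"
    and quadric: "\<And>i. i < dim_row A \<Longrightarrow> A $$ (i, a) + A $$ (i, b) = A $$ (i, e) + A $$ (i, f)"
    and "x + y + z = 0"
    and rel: "\<And>i. i < dim_row A \<Longrightarrow> x * A $$ (i, a) + y * A $$ (i, b) + z * A $$ (i, e) = 0"
  shows "x = 0 \<and> y = 0 \<and> z = 0"
proof -
  have z: "z = - x - y" using assms by simp
  have line: "x * (A $$ (i, a) - A $$ (i, e)) + y * (A $$ (i, b) - A $$ (i, e)) = 0" if "i < dim_row A" for i
    using rel[OF that] by (simp add: z algebra_simps)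
  have "x = 0 \<or> y = 0 \<or> z = 0"
  proof (rule ccontr)
    assume nz: "\<not> ?thesis"
    \<comment> \<open>Equal coefficients would make \<open>e\<close> the midpoint of
      \<open>a\<close> and \<open>b\<close>, and then the quadric gives
      \<open>e = f\<close>.\<close>
    have "x \<noteq> y"
    proof
      assume "x = y"
      have "A $$ (i, e) = A $$ (i, f)" if "i < dim_row A" for i
      proof -
        have "x * (A $$ (i, a) + A $$ (i, b) - 2 * A $$ (i, e)) = 0"
          using line[OF that] \<open>x = y\<close> by (simp add: algebra_simps)
        then show ?thesis using nz quadric[OF that] by simp
      qed
      then show False using col_inj cols ne by blast
    qed
    obtain i where i: "i < dim_row A" "A $$ (i, a) \<noteq> A $$ (i, e)"
      using col_inj cols ne by blast
    have l: "x * (A $$ (i, a) - A $$ (i, e)) = - y * (A $$ (i, b) - A $$ (i, e))"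
      using line[OF i(1)] by simp
    then have be: "A $$ (i, b) \<noteq> A $$ (i, e)" using nz i(2) by auto
    have ab: "A $$ (i, a) \<noteq> A $$ (i, b)"
    proof
      assume "A $$ (i, a) = A $$ (i, b)"
      then have "(x + y) * (A $$ (i, b) - A $$ (i, e)) = 0" using l by (simp add: algebra_simps)
      then show False using be nz z by simp
    qed
    have fe: "A $$ (i, f) \<noteq> A $$ (i, e)"
    proof
      assume "A $$ (i, f) = A $$ (i, e)"
      then have b: "A $$ (i, b) = 2 * A $$ (i, e) - A $$ (i, a)" using quadric[OF i(1)] by simp
      have "(x - y) * (A $$ (i, a) - A $$ (i, e)) = 0" using l unfolding b by (simp add: algebra_simps)
      then show False using i(2) \<open>x \<noteq> y\<close> by simp
    qed
    \<comment> \<open>Columns \<open>a\<close>, \<open>b\<close>, \<open>e\<close> take three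
      distinct values in coordinate \<open>i\<close>, hence 0, 1 and 2 in some order. If
      \<open>e\<close> has the value 1, so does \<open>f\<close>, which \<open>fe\<close> excludes;
      otherwise \<open>f\<close> would have the value 3 or -1.\<close>
    show False
      using entry[OF i(1) cols(1)] entry[OF i(1) cols(2)] entry[OF i(1) cols(3)] entry[OF i(1) cols(4)]
        quadric[OF i(1)] c i(2) be ab fe by linarith
  qed
  then show ?thesis
  proof (elim disjE)
    assume "x = 0"
    then show ?thesis
      using two_columns_independent[OF cols(2,3) ne(3), of y z] rel z by simp
  next
    assume "y = 0"
    then show ?thesis
      using two_columns_independent[OF cols(1,3) ne(2), of x z] rel z by simp
  next
    assume "z = 0"
    then show ?thesis
      using two_columns_independent[OF cols(1,2) ne(1), of x y] rel z by simp
  qed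
qed

text \<open>A column common to both sides cancels and leaves two equal columns, so the sides
  coincide. If both sides were squares, halving would identify \<open>a\<close> with
  \<open>e\<close>.\<close>

lemma quadric_disjoint:
  assumes cols: "a < dim_col A" "b < dim_col A" "e < dim_col A" "f < dim_col A"
    and quadric: "\<And>i. i < dim_row A \<Longrightarrow> A $$ (i, a) + A $$ (i, b) = A $$ (i, e) + A $$ (i, f)"
    and ne: "var a + var b \<noteq> var e + var f"
  shows "a \<noteq> e" "a \<noteq> f" "b \<noteq> e" "b \<noteq> f" "a \<noteq> b \<or> e \<noteq> f"
proof -
  have "A $$ (i, b) = A $$ (i, f)" if "a = e" "i < dim_row A" for i using quadric[OF that(2)] that by simp
  then show ae: "a \<noteq> e" using col_inj[OF cols(2,4)] ne by metis
  have "A $$ (i, b) = A $$ (i, e)" if "a = f" "i < dim_row A" for i using quadric[OF that(2)] that by simp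
  then show "a \<noteq> f" using col_inj[OF cols(2,3)] ne by (metis add.commute)
  have "A $$ (i, a) = A $$ (i, f)" if "b = e" "i < dim_row A" for i using quadric[OF that(2)] that by simp
  then show "b \<noteq> e" using col_inj[OF cols(1,4)] ne by (metis add.commute)
  have "A $$ (i, a) = A $$ (i, e)" if "b = f" "i < dim_row A" for i using quadric[OF that(2)] that by simp
  then show "b \<noteq> f" using col_inj[OF cols(1,3)] ne by metis
  have "A $$ (i, a) = A $$ (i, e)" if "a = b" "e = f" "i < dim_row A" for i using quadric[OF that(3)] that by simp
  then show "a \<noteq> b \<or> e \<noteq> f" using col_inj[OF cols(1,3)] ae by metis
qed

text \<open>A binomial supported on a proper subset yields an affine relation in which some
  coefficient is zero. The remaining columns are affinely independent, so all exponent differences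
  vanish.\<close>

lemma quadric_support_minimal:
  assumes c: "c \<le> 2"
    and cols: "a < dim_col A" "b < dim_col A" "e < dim_col A" "f < dim_col A"
    and quadric: "\<And>i. i < dim_row A \<Longrightarrow> A $$ (i, a) + A $$ (i, b) = A $$ (i, e) + A $$ (i, f)"
    and ne: "var a + var b \<noteq> var e + var f"
    and deg: "toric_degree A u = toric_degree A v"
    and sub: "Poly_Mapping.keys u \<union> Poly_Mapping.keys v \<subset> {a, b, e, f}"
  shows "u = v"
proof -
  note disj = quadric_disjoint[OF cols quadric ne]
  define S where "S = {a, b, e, f}"
  define w where "w j = int (Poly_Mapping.lookup u j) - int (Poly_Mapping.lookup v j)" for j
  have S: "S \<subseteq> {..<dim_col A}" "Poly_Mapping.keys u \<union> Poly_Mapping.keys v \<subseteq> S"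
    using cols sub by (auto simp: S_def)
  note rel = binomial_relation[OF deg S, folded w_def]
  \<comment> \<open>Rewritten so that any of the four columns can be the omitted one in
    \<open>three_of_quadric_independent\<close>.\<close>
  have quadric': "A $$ (i, b) + A $$ (i, a) = A $$ (i, f) + A $$ (i, e)"
      "A $$ (i, e) + A $$ (i, f) = A $$ (i, a) + A $$ (i, b)"
      "A $$ (i, a) + A $$ (i, b) = A $$ (i, f) + A $$ (i, e)"
      "A $$ (i, e) + A $$ (i, f) = A $$ (i, b) + A $$ (i, a)" if "i < dim_row A" for i
    using quadric[OF that] by simp_all
  obtain x where "x \<in> S" "w x = 0"
    using sub by (force simp: S_def w_def in_keys_iff)
  then have zero: "w a = 0 \<or> w b = 0 \<or> w e = 0 \<or> w f = 0" by (auto simp: S_def)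
  have "w a = 0 \<and> w b = 0 \<and> w e = 0 \<and> w f = 0"
  proof (cases "a \<noteq> b \<and> e \<noteq> f")
    case True
    have sum: "w a + w b + w e + w f = 0"
      and rows: "\<And>i. i < dim_row A \<Longrightarrow>
        w a * A $$ (i, a) + w b * A $$ (i, b) + w e * A $$ (i, e) + w f * A $$ (i, f) = 0"
      using rel True disj by (simp_all add: S_def add.assoc)
    from zero show ?thesis
    proof (elim disjE)
      assume "w a = 0"
      then show ?thesis
        using three_of_quadric_independent[OF c cols(3,4,2,1), of "w e" "w f" "w b"] True disj quadric'(4) sum rows
        by (simp add: add_ac)
    next
      assume "w b = 0"
      then show ?thesis
        using three_of_quadric_independent[OF c cols(3,4,1,2), of "w e" "w f" "w a"] True disj quadric'(2) sum rows
        by (simp add: add_ac)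
    next
      assume "w e = 0"
      then show ?thesis
        using three_of_quadric_independent[OF c cols(1,2,4,3), of "w a" "w b" "w f"] True disj quadric'(3) sum rows
        by (simp add: add_ac)
    next
      assume "w f = 0"
      then show ?thesis
        using three_of_quadric_independent[OF c cols(1,2,3,4), of "w a" "w b" "w e"] True disj quadric sum rows
        by (simp add: add_ac)
    qed
  next
    case False
    \<comment> \<open>Exactly one side is a square here, so \<open>S\<close> has three elements;
      \<open>g\<close> is the one besides \<open>a\<close> and \<open>e\<close>.\<close>
    define g where "g = (if a = b then f else b)"
    have g: "g < dim_col A" "g \<noteq> a" "g \<noteq> e" "S = {a, e, g}"
      using cols False disj by (auto simp: g_def S_def)
    have sum: "w a + w e + w g = 0"
      and rows: "\<And>i. i < dim_row A \<Longrightarrow> w a * A $$ (i, a) + w e * A $$ (i, e) + w g * A $$ (i, g) = 0"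
      using rel g(2-4) disj(1) by (simp_all add: add.assoc)
    have "w a = 0 \<or> w e = 0 \<or> w g = 0" using \<open>x \<in> S\<close> \<open>w x = 0\<close> by (auto simp: g(4))
    then have "w a = 0 \<and> w e = 0 \<and> w g = 0"
    proof (elim disjE)
      assume "w a = 0"
      then show ?thesis
        using two_columns_independent[OF cols(3) g(1), of "w e" "w g"] g(3) sum rows by simp
    next
      assume "w e = 0"
      then show ?thesis
        using two_columns_independent[OF cols(1) g(1), of "w a" "w g"] g(2) sum rows by simp
    next
      assume "w g = 0"
      then show ?thesis
        using two_columns_independent[OF cols(1,3), of "w a" "w e"] disj(1) sum rows by simp
    qed
    moreover have "b \<in> {a, e, g}" "f \<in> {a, e, g}" using g(4) by (auto simp: S_def)
    ultimately show ?thesis by auto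
  qed
  then have w_S: "w j = 0" if "j \<in> S" for j using that by (auto simp: S_def)
  have "w j = 0" for j
  proof (cases "j \<in> S")
    case False
    then have "j \<notin> Poly_Mapping.keys u" "j \<notin> Poly_Mapping.keys v" using S(2) by auto
    then show ?thesis by (simp add: w_def in_keys_iff)
  qed (rule w_S)
  then show ?thesis by (intro poly_mapping_eqI) (simp add: w_def)
qed

lemma quadric_circuit:
  assumes c: "c \<le> 2"
    and cols: "a < dim_col A" "b < dim_col A" "e < dim_col A" "f < dim_col A"
    and deg: "toric_degree A (var a + var b) = toric_degree A (var e + var f)"
    and ne: "var a + var b \<noteq> var e + var f"
  shows "mono_poly (var a + var b) - mono_poly (var e + var f) \<in> (circuits A :: 'k::field mpoly set)"
proof -
  let ?u = "var a + var b" and ?v = "var e + var f"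
  let ?f = "mono_poly ?u - mono_poly ?v :: 'k mpoly"
  have quadric: "A $$ (i, a) + A $$ (i, b) = A $$ (i, e) + A $$ (i, f)" if "i < dim_row A" for i
    using deg that unfolding toric_degree_quadric_iff[OF cols] by blast
  note disj = quadric_disjoint[OF cols quadric ne]
  have in_ideal: "?f \<in> toric_ideal A"
    using cols deg by (simp add: binomial_in_toric_ideal_iff[OF ne] keys_add_monomial)
  then have carrier: "?f \<in> carrier (mpoly_ring (dim_col A))" by (simp add: toric_ideal_def)
  have coprime: "Poly_Mapping.keys ?u \<inter> Poly_Mapping.keys ?v = {}"
    using disj by (auto simp: keys_add_monomial)
  \<comment> \<open>A variable of exponent one is required. It is \<open>a\<close> unless the first
    side is a square; then the second is not, and \<open>e\<close> serves with the two sides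
    interchanged.\<close>
  have "ring_irreducible\<^bsub>mpoly_ring (dim_col A)\<^esub> ?f"
  proof (cases "a = b")
    case False
    then show ?thesis
      using disj by (intro binomial_irreducible[OF carrier keys_binomial[OF ne] coprime, of a])
        (auto simp: lookup_add lookup_single when_def)
  next
    case True
    then have "e \<noteq> f" using disj by simp
    moreover have "Poly_Mapping.keys ?f = {?v, ?u}" using keys_binomial[OF ne] by blast
    ultimately show ?thesis
      using disj coprime by (intro binomial_irreducible[OF carrier, of ?v ?u e])
        (auto simp: lookup_add lookup_single when_def)
  qed
  moreover have False if g: "g \<in> toric_ideal A" "is_binomial g" "supp g \<subset> supp ?f" for g :: "'k mpoly"
  proof -
    obtain u v where uv: "u \<noteq> v" "g = mono_poly u - mono_poly v" using g(2) by (auto simp: is_binomial_def)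
    have "u = v"
    proof (rule quadric_support_minimal[OF c cols quadric ne])
      show "toric_degree A u = toric_degree A v"
        using g(1) by (simp add: uv(2) binomial_in_toric_ideal_iff[OF uv(1)])
      show "Poly_Mapping.keys u \<union> Poly_Mapping.keys v \<subset> {a, b, e, f}"
        using g(3) by (simp add: uv(2) supp_binomial uv(1) ne keys_add_monomial insert_commute)
    qed
    then show False using uv(1) by simp
  qed
  ultimately show ?thesis
    using in_ideal ne by (auto simp: circuits_def is_binomial_def)
qed

section \<open>Generation by quadratic circuits\<close>

lemma toric_ideal_eq_genideal:
  fixes S :: "'k::field mpoly set"
  assumes S: "S \<subseteq> circuits A"
    and quadrics: "\<And>a b e f. \<lbrakk>a < dim_col A; b < dim_col A; e < dim_col A; f < dim_col A;
      toric_degree A (var a + var b) = toric_degree A (var e + var f); var a + var b \<noteq> var e + var f\<rbrakk>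
      \<Longrightarrow> mono_poly (var a + var b) - mono_poly (var e + var f) \<in> S"
  shows "toric_ideal A = Idl\<^bsub>mpoly_ring (dim_col A)\<^esub> S"
proof
  interpret R: cring "mpoly_ring (dim_col A) :: 'k mpoly ring" by (rule cring_mpoly_ring)
  have S_toric: "S \<subseteq> toric_ideal A" using S by (auto simp: circuits_def)
  then have S_carrier: "S \<subseteq> carrier (mpoly_ring (dim_col A))" by (auto simp: toric_ideal_def)
  show "Idl\<^bsub>mpoly_ring (dim_col A)\<^esub> S \<subseteq> toric_ideal A"
    by (rule R.genideal_minimal[OF ideal_toric_ideal S_toric])
  \<comment> \<open>The generated ideal takes the role of \<open>J\<close>, and connectivity of the
    fibres gives the nontrivial inclusion.\<close>
  interpret quadric_ideal A c r "Idl\<^bsub>mpoly_ring (dim_col A)\<^esub> S"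
  proof (intro quadric_ideal.intro quadric_ideal_axioms.intro truncated_simplex_axioms)
    show ideal: "ideal (Idl\<^bsub>mpoly_ring (dim_col A)\<^esub> S) (mpoly_ring (dim_col A))"
      by (rule R.genideal_ideal[OF S_carrier])
    fix a b e f assume *: "a < dim_col A" "b < dim_col A" "e < dim_col A" "f < dim_col A"
      "toric_degree A (var a + var b) = toric_degree A (var e + var f)"
    show "mono_poly (var a + var b) - mono_poly (var e + var f) \<in> Idl\<^bsub>mpoly_ring (dim_col A)\<^esub> S"
    proof (cases "var a + var b = var e + var f")
      case True
      then show ?thesis using mpoly_idealD(2)[OF ideal] by simp
    next
      case False
      then show ?thesis using quadrics[OF *] R.genideal_self[OF S_carrier] by blast
    qed
  qed
  show "toric_ideal A \<subseteq> Idl\<^bsub>mpoly_ring (dim_col A)\<^esub> S" by (rule toric_ideal_subset_J)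
qed

text \<open>Neither side of a nontrivial quadric is a square: twice a 0-1 column is a sum of two 0-1
  columns only if all of them are equal.\<close>

lemma toric_ideal_eq_genideal_sfsf:
  assumes "c = 1"
  shows "toric_ideal A = Idl\<^bsub>mpoly_ring (dim_col A)\<^esub> (circuits_sfsf A :: 'k::field mpoly set)"
proof (rule toric_ideal_eq_genideal)
  show "circuits_sfsf A \<subseteq> (circuits A :: 'k mpoly set)" by (auto simp: circuits_sfsf_def)
  fix a b e f assume cols: "a < dim_col A" "b < dim_col A" "e < dim_col A" "f < dim_col A"
    and deg: "toric_degree A (var a + var b) = toric_degree A (var e + var f)"
    and ne: "var a + var b \<noteq> var e + var f"
  have quadric: "A $$ (i, a) + A $$ (i, b) = A $$ (i, e) + A $$ (i, f)" if "i < dim_row A" for i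
    using deg that unfolding toric_degree_quadric_iff[OF cols] by blast
  note disj = quadric_disjoint[OF cols quadric ne]
  have "a \<noteq> b"
  proof
    assume "a = b"
    have "A $$ (i, a) = A $$ (i, e)" if i: "i < dim_row A" for i
      using quadric[OF i] \<open>a = b\<close> assms entry[OF i cols(1)] entry[OF i cols(3)] entry[OF i cols(4)] by auto
    then show False using col_inj[OF cols(1,3)] disj(1) by blast
  qed
  moreover have "e \<noteq> f"
  proof
    assume "e = f"
    have "A $$ (i, a) = A $$ (i, e)" if i: "i < dim_row A" for i
      using quadric[OF i] \<open>e = f\<close> assms entry[OF i cols(1)] entry[OF i cols(2)] entry[OF i cols(3)] by auto
    then show False using col_inj[OF cols(1,3)] disj(1) by blast
  qed
  ultimately show "mono_poly (var a + var b) - mono_poly (var e + var f) \<in> (circuits_sfsf A :: 'k mpoly set)"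
    using quadric_circuit[OF _ cols deg ne] squarefree_var_add ne assms by (auto simp: circuits_sfsf_def)
qed

text \<open>A square may occur, but not on both sides of a nontrivial quadric, so one side is
  squarefree.\<close>

lemma toric_ideal_eq_genideal_sf:
  assumes "c \<le> 2"
  shows "toric_ideal A = Idl\<^bsub>mpoly_ring (dim_col A)\<^esub> (circuits_sf A :: 'k::field mpoly set)"
proof (rule toric_ideal_eq_genideal)
  show "circuits_sf A \<subseteq> (circuits A :: 'k mpoly set)" by (auto simp: circuits_sf_def)
  fix a b e f assume cols: "a < dim_col A" "b < dim_col A" "e < dim_col A" "f < dim_col A"
    and deg: "toric_degree A (var a + var b) = toric_degree A (var e + var f)"
    and ne: "var a + var b \<noteq> var e + var f"
  have quadric: "A $$ (i, a) + A $$ (i, b) = A $$ (i, e) + A $$ (i, f)" if "i < dim_row A" for i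
    using deg that unfolding toric_degree_quadric_iff[OF cols] by blast
  have "squarefree_monomial (var a + var b) \<or> squarefree_monomial (var e + var f)"
    using quadric_disjoint(5)[OF cols quadric ne] squarefree_var_add by blast
  then show "mono_poly (var a + var b) - mono_poly (var e + var f) \<in> (circuits_sf A :: 'k mpoly set)"
    using quadric_circuit[OF assms cols deg ne] ne by (auto simp: circuits_sf_def)
qed

end

section \<open>Degree at least three\<close>

text \<open>The polynomials none of whose monomials divides \<open>u\<close>. A multiple of a
  non-divisor is again a non-divisor. Such an ideal serves to separate generators from a polynomial
  that contains \<open>u\<close>.\<close>

lemma ideal_no_divisor_keys:
  "ideal {p \<in> carrier (mpoly_ring n). \<forall>m\<in>Poly_Mapping.keys p. \<forall>x. m + x \<noteq> u} (mpoly_ring n :: 'k::field mpoly ring)"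
  (is "ideal ?I _")
proof -
  interpret cring "mpoly_ring n :: 'k mpoly ring" by (rule cring_mpoly_ring)
  show ?thesis
  proof (rule mpoly_idealI)
    fix p q :: "'k mpoly" assume pq: "p \<in> ?I" "q \<in> ?I"
    then have "p \<oplus>\<^bsub>mpoly_ring n\<^esub> q \<in> carrier (mpoly_ring n)" by (intro a_closed) auto
    with pq show "p + q \<in> ?I" using Poly_Mapping.keys_add[of p q] by auto
  next
    fix p q :: "'k mpoly" assume pq: "p \<in> ?I" "q \<in> carrier (mpoly_ring n)"
    then have "q \<otimes>\<^bsub>mpoly_ring n\<^esub> p \<in> carrier (mpoly_ring n)" by (intro m_closed) auto
    moreover have "m + x \<noteq> u" if m: "m \<in> Poly_Mapping.keys (q * p)" for m x
    proof
      assume "m + x = u"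
      obtain k l where "m = k + l" "l \<in> Poly_Mapping.keys p" using keys_mult[of q p] m by blast
      then have "l + (k + x) = u" using \<open>m + x = u\<close> by (simp add: ac_simps)
      then show False using pq(1) \<open>l \<in> Poly_Mapping.keys p\<close> by auto
    qed
    ultimately show "q * p \<in> ?I" by simp
  qed (auto simp: carrier_mpoly_ring)
qed

text \<open>With \<open>q\<^sub>k\<close> the column \<open>(r - k, k, 0, \<dots>, 0)\<close>, the binomial \<open>q\<^sub>0 q\<^sub>3 - q\<^sub>1 q\<^sub>2\<close> is the only one in its
  fibre. It is not a circuit, because the support of \<open>q\<^sub>0 q\<^sub>2 - q\<^sub>1\<^sup>2\<close> is smaller.\<close>

lemma (in truncated_simplex) toric_ideal_not_generated_by_circuits:
  fixes S :: "'k::field mpoly set"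
  assumes c: "c = r" and r: "3 \<le> r" and d: "2 \<le> dim_row A" and S: "S \<subseteq> circuits A"
  shows "toric_ideal A \<noteq> Idl\<^bsub>mpoly_ring (dim_col A)\<^esub> S"
proof
  assume gen: "toric_ideal A = Idl\<^bsub>mpoly_ring (dim_col A)\<^esub> S"
  interpret R: cring "mpoly_ring (dim_col A) :: 'k mpoly ring" by (rule cring_mpoly_ring)
  define \<alpha> where "\<alpha> k i = (if i = 0 then r - k else 0) + (if i = 1 then k else 0)" for k :: int and i :: nat
  \<comment> \<open>Two rows give room for the point, \<open>3 \<le> r\<close> makes its entries
    nonnegative, and \<open>c = r\<close> admits the entry \<open>r\<close>.\<close>
  have "\<exists>j<dim_col A. \<forall>i<dim_row A. A $$ (i, j) = \<alpha> k i" if "0 \<le> k" "k \<le> 3" for k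
  proof (rule col_ex)
    show "0 \<le> \<alpha> k i \<and> \<alpha> k i \<le> c" for i using that c r by (simp add: \<alpha>_def)
    show "(\<Sum>i<dim_row A. \<alpha> k i) = r" using d by (simp add: \<alpha>_def sum.distrib)
  qed
  then obtain q where q: "\<And>k. 0 \<le> k \<Longrightarrow> k \<le> 3 \<Longrightarrow> q k < dim_col A"
      "\<And>k i. 0 \<le> k \<Longrightarrow> k \<le> 3 \<Longrightarrow> i < dim_row A \<Longrightarrow> A $$ (i, q k) = \<alpha> k i"
    by metis
  have q_cols: "q 0 < dim_col A" "q 1 < dim_col A" "q 2 < dim_col A" "q 3 < dim_col A"
    using q(1) by auto
  have q_inj: "k = l" if "q k = q l" "0 \<le> k" "k \<le> 3" "0 \<le> l" "l \<le> 3" for k l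
    using q(2)[of k 1] q(2)[of l 1] that d by (simp add: \<alpha>_def)
  have q_ne: "q 0 \<noteq> q 1" "q 0 \<noteq> q 2" "q 0 \<noteq> q 3" "q 1 \<noteq> q 2" "q 1 \<noteq> q 3" "q 2 \<noteq> q 3"
    using q_inj[of 0 1] q_inj[of 0 2] q_inj[of 0 3] q_inj[of 1 2] q_inj[of 1 3] q_inj[of 2 3] by auto
  \<comment> \<open>With zeros from coordinate 2 on, entry 1 determines the column, since the column
    sum fixes entry 0.\<close>
  have q_unique: "a = q k" if a: "a < dim_col A" "0 \<le> k" "k \<le> 3" "A $$ (1, a) = k"
      "\<And>i. 2 \<le> i \<Longrightarrow> i < dim_row A \<Longrightarrow> A $$ (i, a) = 0" for a k
  proof (rule col_inj[OF a(1) q(1)[OF a(2,3)]])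
    have off: "A $$ (i, a) = A $$ (i, q k)" if "i < dim_row A" "i \<noteq> 0" for i
      using a(4) a(5)[OF _ that(1)] q(2)[OF a(2,3) that(1)] that(2) by (cases "i = 1") (auto simp: \<alpha>_def)
    have "(\<Sum>i<dim_row A. A $$ (i, j)) = A $$ (0, j) + (\<Sum>i\<in>{..<dim_row A} - {0}. A $$ (i, j))" for j
      using d by (simp add: sum.remove[of _ 0])
    moreover have "(\<Sum>i<dim_row A. A $$ (i, a)) = (\<Sum>i<dim_row A. A $$ (i, q k))"
      using col_sum a(1) q(1)[OF a(2,3)] by simp
    moreover have "(\<Sum>i\<in>{..<dim_row A} - {0}. A $$ (i, a)) = (\<Sum>i\<in>{..<dim_row A} - {0}. A $$ (i, q k))"
      using off by (intro sum.cong) auto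
    ultimately have "A $$ (0, a) = A $$ (0, q k)" by simp
    then show "A $$ (i, a) = A $$ (i, q k)" if "i < dim_row A" for i
      using off that by (cases "i = 0") auto
  qed
  let ?u = "var (q 0) + var (q 3)" and ?v = "var (q 1) + var (q 2)"
  have coprime: "Poly_Mapping.keys ?u \<inter> Poly_Mapping.keys ?v = {}"
    using q_ne by (auto simp: keys_add_monomial)
  have ne: "?u \<noteq> ?v"
  proof
    assume "?u = ?v"
    then have "Poly_Mapping.keys ?u = {}" using coprime by simp
    then show False by (simp only: keys_add_monomial) simp
  qed
  have deg: "toric_degree A ?u = toric_degree A ?v"
    unfolding toric_degree_quadric_iff[OF q_cols(1,4,2,3)] using q(2) by (simp add: \<alpha>_def)
  \<comment> \<open>Such a monomial is a product of two columns. By nonnegativity both vanish from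
    coordinate 2 on, and their entries in coordinate 1 sum to 3, so these are 0 and 3 or 1 and 2 in
    some order.\<close>
  have fibre: "w = ?u \<or> w = ?v"
    if w: "Poly_Mapping.keys w \<subseteq> {..<dim_col A}" "toric_degree A w = toric_degree A ?u" for w
  proof -
    have size_add: "(\<Sum>j<dim_col A. Poly_Mapping.lookup (var a + x) j) = Suc (\<Sum>j<dim_col A. Poly_Mapping.lookup x j)"
      if "a < dim_col A" for a x
      using that by (simp add: lookup_add sum.distrib lookup_single when_def)
    have size_var: "(\<Sum>j<dim_col A. Poly_Mapping.lookup (var a) j) = 1" if "a < dim_col A" for a
      using size_add[OF that, of 0] by simp
    have size_w: "(\<Sum>j<dim_col A. Poly_Mapping.lookup w j) = 2"
      using toric_degree_eq_size[OF w(2)] size_add[OF q_cols(1)] size_var[OF q_cols(4)] by simp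
    then have "w \<noteq> 0" by auto
    then obtain a x where ax: "w = var a + x"
      by (metis ex_in_conv keys_eq_empty monomial_split_var)
    have a: "a < dim_col A" "Poly_Mapping.keys x \<subseteq> {..<dim_col A}"
      using w(1) by (auto simp: ax keys_add_monomial)
    have size_x: "(\<Sum>j<dim_col A. Poly_Mapping.lookup x j) = 1"
      using size_w size_add[OF a(1), of x] by (simp add: ax)
    then have "x \<noteq> 0" by auto
    then obtain b y where bx: "x = var b + y"
      by (metis ex_in_conv keys_eq_empty monomial_split_var)
    have b: "b < dim_col A" "Poly_Mapping.keys y \<subseteq> {..<dim_col A}"
      using a(2) by (auto simp: bx keys_add_monomial)
    have "y = 0"
      using size_x size_add[OF b(1), of y] by (intro monomial_size_0[OF b(2)]) (simp add: bx)
    then have w_eq: "w = var a + var b" by (simp add: ax bx)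
    have sum: "A $$ (i, a) + A $$ (i, b) = \<alpha> 0 i + \<alpha> 3 i" if "i < dim_row A" for i
      using w(2) that q(2) unfolding w_eq toric_degree_quadric_iff[OF a(1) b(1) q_cols(1,4)] by simp
    have "0 \<le> A $$ (i, a)" "0 \<le> A $$ (i, b)" if "i < dim_row A" for i
      using entry[OF that a(1)] entry[OF that b(1)] by auto
    then have rest: "A $$ (i, a) = 0 \<and> A $$ (i, b) = 0" if "2 \<le> i" "i < dim_row A" for i
      using sum[OF that(2)] that by (fastforce simp: \<alpha>_def)
    have "A $$ (1, a) + A $$ (1, b) = 3" "0 \<le> A $$ (1, a)" "0 \<le> A $$ (1, b)"
      using sum[of 1] entry[of 1 a] entry[of 1 b] a(1) b(1) d by (simp_all add: \<alpha>_def)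
    then have "a = q (A $$ (1, a))" "b = q (3 - A $$ (1, a))"
        "A $$ (1, a) = 0 \<or> A $$ (1, a) = 1 \<or> A $$ (1, a) = 2 \<or> A $$ (1, a) = 3"
      using rest a(1) b(1) by (auto intro!: q_unique)
    then show ?thesis unfolding w_eq by (elim disjE) (simp_all add: add.commute)
  qed
  let ?h = "mono_poly (var (q 0) + var (q 2)) - mono_poly (var (q 1) + var (q 1)) :: 'k mpoly"
  have smaller: "?h \<in> toric_ideal A"
    and h_binomial: "is_binomial ?h" and h_supp: "supp ?h = {q 0, q 1, q 2}"
  proof -
    have ne': "var (q 0) + var (q 2) \<noteq> var (q 1) + var (q 1)"
    proof
      assume "var (q 0) + var (q 2) = var (q 1) + var (q 1)"
      from arg_cong[OF this, of "\<lambda>m. Poly_Mapping.lookup m (q 0)"] q_ne show False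
        by (simp add: lookup_add lookup_single when_def)
    qed
    show "?h \<in> toric_ideal A"
      unfolding binomial_in_toric_ideal_iff[OF ne'] toric_degree_quadric_iff[OF q_cols(1,3,2,2)]
      using q_cols q(2) by (simp add: keys_add_monomial \<alpha>_def)
    show "is_binomial ?h" using ne' by (auto simp: is_binomial_def)
    show "supp ?h = {q 0, q 1, q 2}" by (auto simp: supp_binomial[OF ne'] keys_add_monomial)
  qed
  \<comment> \<open>Multiplication by \<open>x\<close> takes \<open>m'\<close> into the fibre of
    \<open>?u\<close>, hence to \<open>?v\<close>. Then \<open>x\<close> divides the coprime
    monomials \<open>?u\<close> and \<open>?v\<close>, so \<open>x = 0\<close>.\<close>
  have divisor: "m = ?u \<and> m' = ?v"
    if m: "m \<noteq> m'" "Poly_Mapping.keys m' \<subseteq> {..<dim_col A}" "toric_degree A m = toric_degree A m'" "m + x = ?u" for m m' x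
  proof -
    have x: "Poly_Mapping.keys x \<subseteq> Poly_Mapping.keys ?u"
      using m(4) by (metis Un_upper2 keys_add_monomial)
    moreover have "Poly_Mapping.keys ?u \<subseteq> {..<dim_col A}" using q_cols by (simp add: keys_add_monomial)
    ultimately have "Poly_Mapping.keys (m' + x) \<subseteq> {..<dim_col A}"
      using m(2) unfolding keys_add_monomial by blast
    moreover have "toric_degree A (m' + x) = toric_degree A ?u"
      using m(3) by (simp add: m(4)[symmetric] toric_degree_add)
    ultimately have "m' + x = ?u \<or> m' + x = ?v" by (rule fibre)
    moreover have "m' + x \<noteq> ?u" using m(1,4) by (metis add_right_cancel)
    ultimately have v: "m' + x = ?v" by blast
    then have "Poly_Mapping.keys x \<subseteq> Poly_Mapping.keys ?v" by (metis Un_upper2 keys_add_monomial)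
    then have "Poly_Mapping.keys x = {}" using x coprime by blast
    then have "x = 0" by simp
    then show ?thesis using m(4) v by simp
  qed
  \<comment> \<open>A circuit with a monomial dividing \<open>?u\<close> would be
    \<open>?u - ?v\<close> up to sign, whose support strictly contains that of
    \<open>?h\<close>.\<close>
  have "circuits A \<subseteq> {p \<in> carrier (mpoly_ring (dim_col A)) :: 'k mpoly set. \<forall>m\<in>Poly_Mapping.keys p. \<forall>x. m + x \<noteq> ?u}"
  proof
    fix g :: "'k mpoly" assume g: "g \<in> circuits A"
    then have toric: "g \<in> toric_ideal A" and "is_binomial g"
      and minimal: "\<And>h :: 'k mpoly. h \<in> toric_ideal A \<Longrightarrow> is_binomial h \<Longrightarrow> \<not> supp h \<subset> supp g"
      by (auto simp: circuits_def)
    then obtain m m' where mm': "m \<noteq> m'" "g = mono_poly m - mono_poly m'" by (auto simp: is_binomial_def)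
    have keys: "Poly_Mapping.keys m \<subseteq> {..<dim_col A}" "Poly_Mapping.keys m' \<subseteq> {..<dim_col A}"
        "toric_degree A m = toric_degree A m'"
      using toric by (simp_all add: mm'(2) binomial_in_toric_ideal_iff[OF mm'(1)])
    have "k + x \<noteq> ?u" if "k \<in> Poly_Mapping.keys g" for k x
    proof
      assume kx: "k + x = ?u"
      have "k = m \<or> k = m'" using that by (simp add: mm'(2) keys_binomial[OF mm'(1)])
      then have "{m, m'} = {?u, ?v}"
        using divisor[OF mm'(1) keys(2,3), of x] divisor[OF mm'(1)[symmetric] keys(1) keys(3)[symmetric], of x] kx by auto
      then have "Poly_Mapping.keys m \<union> Poly_Mapping.keys m' = Poly_Mapping.keys ?u \<union> Poly_Mapping.keys ?v"
        by (auto simp: doubleton_eq_iff)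
      then have "supp g = {q 0, q 1, q 2, q 3}"
        by (auto simp: mm'(2) supp_binomial[OF mm'(1)] keys_add_monomial)
      moreover have "q 3 \<notin> {q 0, q 1, q 2}" using q_ne by auto
      ultimately have "supp ?h \<subset> supp g" unfolding h_supp by blast
      then show False using minimal[OF smaller h_binomial] by blast
    qed
    then show "g \<in> {p \<in> carrier (mpoly_ring (dim_col A)). \<forall>m\<in>Poly_Mapping.keys p. \<forall>x. m + x \<noteq> ?u}"
      using toric by (auto simp: toric_ideal_def)
  qed
  \<comment> \<open>If circuits generated, no element of the toric ideal would have a monomial
    dividing \<open>?u\<close>. But \<open>?u - ?v\<close> has the monomial \<open>?u\<close>
    itself, the case \<open>x = 0\<close>.\<close>
  then have "toric_ideal A \<subseteq> {p \<in> carrier (mpoly_ring (dim_col A)) :: 'k mpoly set. \<forall>m\<in>Poly_Mapping.keys p. \<forall>x. m + x \<noteq> ?u}"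
    unfolding gen using S by (intro R.genideal_minimal ideal_no_divisor_keys) auto
  moreover have "mono_poly ?u - mono_poly ?v \<in> (toric_ideal A :: 'k mpoly set)"
    using deg q_cols by (simp add: binomial_in_toric_ideal_iff[OF ne] keys_add_monomial)
  ultimately have "?u + 0 \<noteq> ?u"
    using keys_binomial[OF ne, where 'k = 'k] by blast
  then show False by simp
qed

section \<open>The two matrices as truncated simplices\<close>

lemma truncated_simplexI:
  assumes dim: "dim_row A = d" and dist: "distinct (cols A)" and r: "0 < r"
    and cols: "set (cols A) = {\<alpha> \<in> carrier_vec d. (\<forall>i<d. 0 \<le> \<alpha> $ i \<and> \<alpha> $ i \<le> c) \<and> (\<Sum>i<d. \<alpha> $ i) = r}"
  shows "truncated_simplex A c r"
proof
  have col: "(\<forall>i<d. 0 \<le> A $$ (i, j) \<and> A $$ (i, j) \<le> c) \<and> (\<Sum>i<d. A $$ (i, j)) = r" if j: "j < dim_col A" for j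
  proof -
    have "col A j \<in> set (cols A)" using j by (auto simp: cols_def)
    then show ?thesis using j by (simp add: cols dim)
  qed
  show "0 < r" by (rule r)
  show "0 \<le> A $$ (i, j) \<and> A $$ (i, j) \<le> c" if "i < dim_row A" "j < dim_col A" for i j
    using col[OF that(2)] that(1) dim by simp
  show "(\<Sum>i<dim_row A. A $$ (i, j)) = r" if "j < dim_col A" for j
    using col[OF that] dim by simp
  show "j = k" if jk: "j < dim_col A" "k < dim_col A" "\<And>i. i < dim_row A \<Longrightarrow> A $$ (i, j) = A $$ (i, k)" for j k
  proof -
    have "col A j = col A k" using jk by (intro eq_vecI) auto
    then have "cols A ! j = cols A ! k" using jk by simp
    then show ?thesis using nth_eq_iff_index_eq[OF dist] jk(1,2) by simp
  qed
  show "\<exists>j<dim_col A. \<forall>i<dim_row A. A $$ (i, j) = \<alpha> i"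
    if \<alpha>: "\<And>i. i < dim_row A \<Longrightarrow> 0 \<le> \<alpha> i \<and> \<alpha> i \<le> c" "(\<Sum>i<dim_row A. \<alpha> i) = r" for \<alpha>
  proof -
    have "vec d \<alpha> \<in> set (cols A)" using \<alpha> by (simp add: cols dim)
    then obtain j where j: "j < dim_col A" "vec d \<alpha> = col A j" by (auto simp: in_set_conv_nth)
    have "A $$ (i, j) = \<alpha> i" if "i < dim_row A" for i
      using arg_cong[OF j(2), of "\<lambda>v. v $ i"] that j(1) dim by simp
    then show ?thesis using j(1) by blast
  qed
qed

lemma is_SV_truncated_simplex:
  assumes "is_SV d r A" "0 < r"
  shows "truncated_simplex A 1 (int r)"
proof (rule truncated_simplexI)
  have "x \<in> {0, 1} \<longleftrightarrow> 0 \<le> x \<and> x \<le> 1" for x :: int by auto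
  then show "set (cols A) = {\<alpha> \<in> carrier_vec d. (\<forall>i<d. 0 \<le> \<alpha> $ i \<and> \<alpha> $ i \<le> 1) \<and> (\<Sum>i<d. \<alpha> $ i) = int r}"
    using assms(1) by (simp add: is_SV_def)
qed (use assms in \<open>simp_all add: is_SV_def\<close>)

text \<open>Nonnegative entries are bounded by their sum, so the truncation at \<open>r\<close>
  removes no column.\<close>

lemma is_V_truncated_simplex:
  assumes "is_V d r A" "0 < r"
  shows "truncated_simplex A (int r) (int r)"
proof (rule truncated_simplexI)
  have "\<alpha> $ i \<le> int r" if "\<forall>i<d. 0 \<le> \<alpha> $ i" "(\<Sum>i<d. \<alpha> $ i) = int r" "i < d" for \<alpha> :: "int vec" and i
    using that member_le_sum[of i "{..<d}" "\<lambda>i. \<alpha> $ i"] by auto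
  then have "(\<forall>i<d. 0 \<le> \<alpha> $ i) \<and> (\<Sum>i<d. \<alpha> $ i) = int r \<longleftrightarrow>
      (\<forall>i<d. 0 \<le> \<alpha> $ i \<and> \<alpha> $ i \<le> int r) \<and> (\<Sum>i<d. \<alpha> $ i) = int r" for \<alpha> :: "int vec"
    by blast
  then show "set (cols A) = {\<alpha> \<in> carrier_vec d. (\<forall>i<d. 0 \<le> \<alpha> $ i \<and> \<alpha> $ i \<le> int r) \<and> (\<Sum>i<d. \<alpha> $ i) = int r}"
    using assms(1) by (simp add: is_V_def)
qed (use assms in \<open>simp_all add: is_V_def\<close>)

theorem theorem1p3:
  fixes d r :: nat
  assumes "d \<ge> 2" and "r \<ge> 2"
  shows "(\<forall>A. is_SV d r A \<longrightarrow>
            toric_ideal A =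
              Idl\<^bsub>mpoly_ring (dim_col A)\<^esub> (circuits_sfsf A :: 'k::field mpoly set)) \<and>
         (\<forall>A. is_V d r A \<longrightarrow>
            (toric_ideal A =
              Idl\<^bsub>mpoly_ring (dim_col A)\<^esub> (circuits_sf A :: 'k mpoly set) \<longleftrightarrow> r = 2))"
proof (intro conjI allI impI)
  fix A assume "is_SV d r A"
  then interpret truncated_simplex A 1 "int r" using assms by (intro is_SV_truncated_simplex) auto
  show "toric_ideal A = Idl\<^bsub>mpoly_ring (dim_col A)\<^esub> (circuits_sfsf A :: 'k mpoly set)"
    by (rule toric_ideal_eq_genideal_sfsf) simp
next
  fix A assume V: "is_V d r A"
  then interpret truncated_simplex A "int r" "int r" using assms by (intro is_V_truncated_simplex) auto
  show "toric_ideal A = Idl\<^bsub>mpoly_ring (dim_col A)\<^esub> (circuits_sf A :: 'k mpoly set) \<longleftrightarrow> r = 2"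
  proof
    assume "r = 2"
    then show "toric_ideal A = Idl\<^bsub>mpoly_ring (dim_col A)\<^esub> (circuits_sf A :: 'k mpoly set)"
      by (intro toric_ideal_eq_genideal_sf) simp
  next
    assume gen: "toric_ideal A = Idl\<^bsub>mpoly_ring (dim_col A)\<^esub> (circuits_sf A :: 'k mpoly set)"
    have sub: "circuits_sf A \<subseteq> (circuits A :: 'k mpoly set)" by (auto simp: circuits_sf_def)
    \<comment> \<open>For \<open>r\<close> at least 3 no set of circuits generates, in particular
      not \<open>circuits_sf A\<close>.\<close>
    have "\<not> 3 \<le> int r"
      using toric_ideal_not_generated_by_circuits[OF refl _ _ sub] gen V assms by (auto simp: is_V_def)
    then show "r = 2" using assms by simp
  qed
qed

end
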